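(* For all ordinals $\alpha$, $\beta$, $\gamma$, \[ \alpha^{\otimes(\beta\times\gamma)} = (\alpha^{\otimes\beta})^{\otimes\gamma}. \] More generally, for ordinals $\alpha$ and $\gamma$ and any family of ordinals $(\beta_i)_{i<\gamma}$, \[ \alpha^{\otimes\left(\bigoplus_{i<\gamma}\beta_i\right)} = \bigotimes_{i<\gamma}\alpha^{\otimes\beta_i}. \]
   Context: Every ordinal has a unique Cantor normal form $\omega^{\alpha_0}a_0+\dots+\omega^{\alpha_r}a_r$ with $\alpha_0>\dots>\alpha_r$ and positive integers $a_i$. The natural sum $\oplus$ adds Cantor normal forms as polynomials in $\omega$ (coefficientwise over common exponents). The natural product is $\alpha\otimes\beta=\bigoplus_{i,j}\omega^{\alpha_i\oplus\beta_j}a_ib_j$ for Cantor normal forms $\alpha=\sum_i\omega^{\alpha_i}a_i$, $\beta=\sum_j\omega^{\beta_j}b_j$. Jacobsthal multiplication $\alpha\times\beta$ is defined by recursion on $\beta$: $\alpha\times0=0$, $\alpha\times(\beta+1)=(\alpha\times\beta)\oplus\alpha$, and $\alpha\times\beta=\sup_{\delta<\beta}\alpha\times\delta$ for limit $\beta$. Super-Jacobsthal exponentiation: $\alpha^{\otimes0}=1$, $\alpha^{\otimes(\beta+1)}=(\alpha^{\otimes\beta})\otimes\alpha$, $\alpha^{\otimes\beta}=\sup_{\delta<\beta}\alpha^{\otimes\delta}$ for limit $\beta$. Infinitary natural sums and products are defined by transfinite recursion on the length: $\bigoplus_{i<0}\beta_i=0$, $\bigoplus_{i<\delta+1}\beta_i=(\bigoplus_{i<\delta}\beta_i)\oplus\beta_\delta$,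 and $\bigoplus_{i<\lambda}\beta_i=\sup_{\delta<\lambda}\bigoplus_{i<\delta}\beta_i$ for limit $\lambda$; likewise $\bigotimes_{i<0}\mu_i=1$, $\bigotimes_{i<\delta+1}\mu_i=(\bigotimes_{i<\delta}\mu_i)\otimes\mu_\delta$, and $\bigotimes_{i<\lambda}\mu_i=\sup_{\delta<\lambda}\bigotimes_{i<\delta}\mu_i$ for limit $\lambda$. (Thus $\beta\times\gamma=\bigoplus_{i<\gamma}\beta$.)
   Formalization: The second identity is proved unless α = 0, γ is infinite and some β_i = 0; in that case it can fail, e.g. α = 0, γ = ω, β_0 = 1, β_i = 0 for i ≥ 1 gives 0 on the left and 1 on the right. *)

theory Defs
  imports Complex_Main "HOL-Library.Poly_Mapping"
begin

unbundle cardinal_syntax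

section \<open>Ordinals\<close>

text \<open>
  An ordinal is an isomorphism class of well-orders (on subsets of a carrier type). HOL has no
  type of all ordinals; the type \<open>'a ordinal\<close> consists of the ordinals below the successor
  cardinal of the cardinality of \<open>nat + 'a\<close>. The carrier \<open>nat + 'a\<close> is infinite, so this
  is closed under all the operations below (see \<open>ordinal_small_bounded\<close>), and since \<open>'a\<close> is an
  arbitrary type, a statement that is polymorphic in \<open>'a\<close> speaks about all ordinals.
\<close>

quotient_type 'a ordinal = "(nat + 'a) rel" / partial: "\<lambda>r s. r =o s"
proof (rule part_equivpI)
  show "\<exists>r :: (nat + 'a) rel. r =o r"
    using card_of_refl by blast
qed (auto intro!: sympI transpI intro: ordIso_symmetric ordIso_transitive)

lemma Well_order_rep_ordinal: "Well_order (rep_ordinal x)"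
  using Quotient3_rep_reflp[OF Quotient3_ordinal, of x] by (auto simp: ordIso_def)

lemma rep_ordinal_ordIso_iff: "rep_ordinal x =o rep_ordinal y \<longleftrightarrow> x = y"
  using Quotient3_rel_rep[OF Quotient3_ordinal, of x y] by simp

instantiation ordinal :: (type) linorder
begin

lift_definition less_eq_ordinal :: "'a ordinal \<Rightarrow> 'a ordinal \<Rightarrow> bool" is "\<lambda>r s. r \<le>o s"
  by (meson ordIso_ordLeq_trans ordIso_symmetric ordLeq_ordIso_trans)

lift_definition less_ordinal :: "'a ordinal \<Rightarrow> 'a ordinal \<Rightarrow> bool" is "\<lambda>r s. r <o s"
  by (meson ordIso_ordLess_trans ordIso_symmetric ordLess_ordIso_trans)

instance
proof
  fix x y z :: "'a ordinal"
  note wo = Well_order_rep_ordinal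
  note rep = less_eq_ordinal.rep_eq less_ordinal.rep_eq
  show "x < y \<longleftrightarrow> x \<le> y \<and> \<not> y \<le> x"
    unfolding rep
    using ordLess_imp_ordLeq[of "rep_ordinal x" "rep_ordinal y"]
      not_ordLeq_iff_ordLess[OF wo[of x] wo[of y]]
    by blast
  show "x \<le> x"
    unfolding rep by (rule ordLeq_reflexive[OF wo])
  show "x \<le> z" if "x \<le> y" "y \<le> z"
    using that unfolding rep by (rule ordLeq_transitive)
  show "x = y" if "x \<le> y" "y \<le> x"
    using that unfolding rep rep_ordinal_ordIso_iff[symmetric] by (simp add: ordIso_iff_ordLeq)
  show "x \<le> y \<or> y \<le> x"
    unfolding rep by (rule ordLeq_total[OF wo wo])
qed

end

lemma wf_less_ordinal: "wf {(x, y :: 'a ordinal). x < y}"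
proof (rule wf_subset)
  show "wf (inv_image ordLess (rep_ordinal :: 'a ordinal \<Rightarrow> _))"
    by (rule wf_inv_image[OF wf_ordLess])
  show "{(x, y :: 'a ordinal). x < y} \<subseteq> inv_image ordLess rep_ordinal"
    by (auto simp: less_ordinal.rep_eq)
qed

instance ordinal :: (type) wellorder
proof
  fix P :: "'a ordinal \<Rightarrow> bool" and a
  assume "\<And>x. (\<And>y. y < x \<Longrightarrow> P y) \<Longrightarrow> P x"
  then show "P a"
    using wf_induct_rule[OF wf_less_ordinal, of P a] by auto
qed

instantiation ordinal :: (type) "{conditionally_complete_linorder, order_bot}"
begin

definition "bot_ordinal = (LEAST x :: 'a ordinal. True)"
definition "inf_ordinal = (min :: 'a ordinal \<Rightarrow> _)"
definition "sup_ordinal = (max :: 'a ordinal \<Rightarrow> _)"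
definition "Inf_ordinal (X :: 'a ordinal set) = (LEAST x. x \<in> X)"
definition "Sup_ordinal (X :: 'a ordinal set) = (LEAST u. \<forall>x\<in>X. x \<le> u)"

instance
proof
  fix x y z :: "'a ordinal" and X :: "'a ordinal set"
  show "bot \<le> x"
    by (simp add: bot_ordinal_def Least_le)
  show "Inf X \<le> x" if "x \<in> X"
    using that by (simp add: Inf_ordinal_def Least_le)
  show "z \<le> Inf X" if "X \<noteq> {}" "\<And>x. x \<in> X \<Longrightarrow> z \<le> x"
    using that LeastI_ex[of "\<lambda>x. x \<in> X"] by (auto simp: Inf_ordinal_def)
  show "x \<le> Sup X" if "x \<in> X" "bdd_above X"
    using that LeastI_ex[of "\<lambda>u. \<forall>x\<in>X. x \<le> u"] by (auto simp: Sup_ordinal_def bdd_above_def)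
  show "Sup X \<le> z" if "\<And>x. x \<in> X \<Longrightarrow> x \<le> z"
    using that by (simp add: Sup_ordinal_def Least_le)
qed (auto simp: inf_ordinal_def sup_ordinal_def)

end

lemma ordinal_small_bounded:
  fixes A :: "'a ordinal set"
  assumes "|A| \<le>o |UNIV :: (nat + 'a) set|"
  shows "\<exists>u. \<forall>x\<in>A. x < u"
proof -
  let ?U = "UNIV :: (nat + 'a) set"
  define K where "K = cardSuc |?U|"
  have inf: "infinite ?U"
    by simp
  have co: "Card_order K"
    unfolding K_def by (rule cardSuc_Card_order[OF card_of_Card_order])
  then have wK: "Well_order K"
    by (simp add: card_order_on_well_order_on)
  have UK: "|?U| <o K"
    unfolding K_def by (rule cardSuc_greater[OF card_of_Card_order])
  have infK: "infinite (Field K)"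
    using inf unfolding K_def by (simp add: cardSuc_finite[OF card_of_Card_order] Field_card_of)
  have small: "r <o K" if "Well_order r" for r :: "(nat + 'a) rel"
  proof (rule ccontr)
    assume "\<not> r <o K"
    then have "K \<le>o r"
      using that wK not_ordLess_iff_ordLeq by blast
    then have "|Field K| \<le>o |Field r|"
      by (rule card_of_mono2)
    also have "|Field r| \<le>o |?U|"
      by (simp add: card_of_mono1)
    finally have "K \<le>o |?U|"
      using card_of_Field_ordIso[OF co] ordIso_ordLeq_trans ordIso_symmetric by blast
    then show False
      using UK not_ordLess_ordLeq by blast
  qed
  have "\<exists>p. p \<in> Field K \<and> rep_ordinal x =o Restr K (underS K p)" for x :: "'a ordinal"
  proof -
    show ?thesis
      using small ordLess_iff_ordIso_Restr[OF wK] Well_order_rep_ordinal[of x] by blast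
  qed
  then obtain p where p: "\<And>x. p x \<in> Field K"
      "\<And>x :: 'a ordinal. rep_ordinal x =o Restr K (underS K (p x))"
    by metis
  have "|p ` A| <o K"
    using card_of_image assms UK ordLeq_transitive ordLeq_ordLess_trans by blast
  moreover have "regularCard K"
    unfolding K_def using inf
    by (intro infinite_cardSuc_regularCard card_of_Card_order) (simp add: Field_card_of)
  moreover have "p ` A \<subseteq> Field K"
    using p(1) by blast
  ultimately have "\<not> cofinal (p ` A) K"
    unfolding regularCard_def using not_ordLess_ordIso by blast
  then obtain k where k: "k \<in> Field K" "\<And>x. x \<in> A \<Longrightarrow> p x = k \<or> (k, p x) \<notin> K"
    by (auto simp: cofinal_def)
  obtain l where l: "l \<noteq> k" "(k, l) \<in> K"
    using infinite_Card_order_limit[OF co infK k(1)] by auto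
  have lF: "l \<in> Field K"
    using l(2) by (auto simp: Field_def)
  have wr: "wo_rel K"
    using wK by (simp add: wo_rel_def)
  have below: "p x \<in> underS K l" if "x \<in> A" for x
  proof -
    have "(p x, k) \<in> K"
      using k(2)[OF that] p(1)[of x] k(1) wo_rel.TOTALS[OF wr] by metis
    then have "(p x, l) \<in> K"
      using l(2) wo_rel.TRANS[OF wr] by (meson transD)
    moreover have "p x \<noteq> l"
      using \<open>(p x, k) \<in> K\<close> l wo_rel.ANTISYM[OF wr] by (metis antisymD)
    ultimately show ?thesis
      by (simp add: underS_def)
  qed
  have of: "ofilter K (underS K q)" for q
    by (rule wo_rel.underS_ofilter[OF wr])
  let ?R = "Restr K (underS K l)"
  have wR: "Well_order ?R"
    by (rule Well_order_Restr[OF wK])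
  have FR: "Field ?R = underS K l"
    by (rule Field_Restr_ofilter[OF wK of])
  have "|underS K l| <o K"
    by (rule card_of_underS[OF co lF])
  then have "|underS K l| \<le>o |?U|"
    unfolding K_def by (simp add: cardSuc_ordLeq_ordLess[OF card_of_Card_order card_of_Card_order])
  then obtain g :: "_ \<Rightarrow> nat + 'a" where g: "inj_on g (Field ?R)"
    unfolding FR card_of_ordLeq[symmetric] by auto
  have iso: "?R =o dir_image ?R g"
    by (rule dir_image_ordIso[OF wR g])
  have wD: "dir_image ?R g =o dir_image ?R g"
    by (rule ordIso_reflexive[OF Well_order_dir_image[OF wR g]])
  define u where "u = abs_ordinal (dir_image ?R g)"
  have ru: "?R =o rep_ordinal u"
    using Quotient3_rep_abs[OF Quotient3_ordinal wD] iso ordIso_transitive ordIso_symmetric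
    unfolding u_def by blast
  have "x < u" if "x \<in> A" for x
  proof -
    have "underS K (p x) \<subset> underS K l"
      using below[OF that] wo_rel.ofilter_linord[OF wr of of, of "p x" l]
      by (auto simp: underS_def)
    then have "Restr K (underS K (p x)) <o ?R"
      using ofilter_subset_ordLess[OF wK of of] by blast
    then have "rep_ordinal x <o rep_ordinal u"
      using p(2) ru ordIso_ordLess_trans ordLess_ordIso_trans by blast
    then show ?thesis
      by (simp add: less_ordinal.rep_eq)
  qed
  then show ?thesis
    by blast
qed

lemma card_lessThan_ordinal: "|{..<x :: 'a ordinal}| \<le>o |UNIV :: (nat + 'a) set|"
proof -
  define r where "r = rep_ordinal x"
  have "\<exists>a\<in>Field r. rep_ordinal y =o Restr r (underS r a)" if "y < x" for y
    using that ordLess_iff_ordIso_Restr[OF Well_order_rep_ordinal Well_order_rep_ordinal]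
    unfolding r_def less_ordinal.rep_eq by blast
  then obtain q where q: "\<And>y. y < x \<Longrightarrow> rep_ordinal y =o Restr r (underS r (q y))"
    by metis
  have "inj_on q {..<x}"
  proof (rule inj_onI)
    fix y z assume "y \<in> {..<x}" "z \<in> {..<x}" "q y = q z"
    then have "rep_ordinal y =o rep_ordinal z"
      using q[of y] ordIso_symmetric[OF q[of z]] ordIso_transitive by auto
    then show "y = z"
      by (simp add: rep_ordinal_ordIso_iff)
  qed
  then show ?thesis
    using card_of_ordLeq by blast
qed

lemma bdd_above_image_lessThan_ordinal:
  fixes f :: "'a ordinal \<Rightarrow> 'a ordinal"
  shows "bdd_above (f ` {..<x})"
proof -
  have "|f ` {..<x}| \<le>o |UNIV :: (nat + 'a) set|"
    using card_of_image card_lessThan_ordinal ordLeq_transitive by blast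
  then show ?thesis
    using ordinal_small_bounded unfolding bdd_above_def by (meson less_imp_le)
qed

lemma bdd_above_range_nat_ordinal:
  fixes f :: "nat \<Rightarrow> 'a ordinal"
  shows "bdd_above (range f)"
proof -
  have "|UNIV :: nat set| \<le>o |UNIV :: (nat + 'a) set|"
    by (rule card_of_ordLeqI[of Inl]) auto
  then have "|range f| \<le>o |UNIV :: (nat + 'a) set|"
    using card_of_image ordLeq_transitive by blast
  then show ?thesis
    using ordinal_small_bounded unfolding bdd_above_def by (meson less_imp_le)
qed


section \<open>Transfinite recursion\<close>

instantiation ordinal :: (type) zero
begin
definition "zero_ordinal = (bot :: 'a ordinal)"
instance ..
end

definition osuc :: "'a ordinal \<Rightarrow> 'a ordinal" where
  "osuc x = (LEAST y. x < y)"

lemma less_osuc: "x < osuc x"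
proof -
  have "|{x}| \<le>o |UNIV :: (nat + 'a) set|"
    by (rule card_of_singl_ordLeq) simp
  then show ?thesis
    unfolding osuc_def using ordinal_small_bounded[of "{x}"] LeastI_ex[of "\<lambda>y. x < y"] by auto
qed

lemma osuc_le_iff: "osuc x \<le> y \<longleftrightarrow> x < y"
  using less_osuc[of x] by (auto simp: osuc_def intro: Least_le)

lemma osuc_inject [simp]: "osuc x = osuc y \<longleftrightarrow> x = y"
  by (metis less_osuc not_less osuc_le_iff linorder_cases)

lemma zero_le_ordinal [simp]: "(0 :: 'a ordinal) \<le> x"
  by (simp add: zero_ordinal_def)

lemma osuc_neq_zero [simp]: "osuc x \<noteq> 0"
  by (metis less_osuc not_less zero_le_ordinal)

definition limit_ord :: "'a ordinal \<Rightarrow> bool" where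
  "limit_ord b \<longleftrightarrow> b \<noteq> 0 \<and> (\<nexists>d. b = osuc d)"

function ord_rec ::
  "'a ordinal \<Rightarrow> ('a ordinal \<Rightarrow> 'a ordinal \<Rightarrow> 'a ordinal) \<Rightarrow> 'a ordinal \<Rightarrow> 'a ordinal" where
  "ord_rec z s b =
     (if b = 0 then z
      else if \<exists>d. b = osuc d then s (THE d. b = osuc d) (ord_rec z s (THE d. b = osuc d))
      else (SUP d\<in>{..<b}. ord_rec z s d))"
  by auto
termination
  by (relation "inv_image {(x, y). x < y} (\<lambda>(z, s, b). b)")
    (auto simp: less_osuc intro: wf_inv_image wf_less_ordinal)

declare ord_rec.simps [simp del]

lemma ord_rec_0: "ord_rec z s 0 = z"
  by (simp add: ord_rec.simps)

lemma ord_rec_osuc: "ord_rec z s (osuc d) = s d (ord_rec z s d)"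
  by (subst ord_rec.simps) auto

lemma ord_rec_limit: "limit_ord b \<Longrightarrow> ord_rec z s b = (SUP d\<in>{..<b}. ord_rec z s d)"
  by (subst ord_rec.simps) (auto simp: limit_ord_def)


section \<open>Ordinary ordinal arithmetic and Cantor normal form\<close>

instantiation ordinal :: (type) "{one, plus, times}"
begin
definition "one_ordinal = (osuc 0 :: 'a ordinal)"
definition "plus_ordinal (a :: 'a ordinal) b = ord_rec a (\<lambda>_ x. osuc x) b"
definition "times_ordinal (a :: 'a ordinal) b = ord_rec 0 (\<lambda>_ x. x + a) b"
instance ..
end

definition opow :: "'a ordinal \<Rightarrow> 'a ordinal \<Rightarrow> 'a ordinal" where
  "opow a b = ord_rec 1 (\<lambda>_ x. x * a) b"

definition ord_of_nat :: "nat \<Rightarrow> 'a ordinal" where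
  "ord_of_nat n = (osuc ^^ n) 0"

definition omega :: "'a ordinal" (\<open>\<omega>\<close>) where
  "\<omega> = (SUP n. ord_of_nat n)"

text \<open>
  A Cantor normal form is given by its coefficients: a finitely supported function from exponents
  to natural numbers, whose support is the set of exponents that occur (with positive coefficient).
  The terms are added in order of decreasing exponents.
\<close>

definition exponents :: "('a ordinal \<Rightarrow>\<^sub>0 nat) \<Rightarrow> 'a ordinal list" where
  "exponents p = rev (sorted_list_of_set (Poly_Mapping.keys p))"

definition cnf_value :: "('a ordinal \<Rightarrow>\<^sub>0 nat) \<Rightarrow> 'a ordinal" where
  "cnf_value p =
     foldr (\<lambda>e x. opow \<omega> e * ord_of_nat (Poly_Mapping.lookup p e) + x) (exponents p) 0"

definition cnf :: "'a ordinal \<Rightarrow> ('a ordinal \<Rightarrow>\<^sub>0 nat)" where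
  "cnf a = (THE p. cnf_value p = a)"


section \<open>Natural operations and their transfinite iterations\<close>

definition nat_sum :: "'a ordinal \<Rightarrow> 'a ordinal \<Rightarrow> 'a ordinal" (infixl \<open>\<oplus>\<close> 65) where
  "a \<oplus> b = cnf_value (cnf a + cnf b)"

definition nat_prod :: "'a ordinal \<Rightarrow> 'a ordinal \<Rightarrow> 'a ordinal" (infixl \<open>\<otimes>\<close> 70) where
  "a \<otimes> b = foldr (\<oplus>)
     [opow \<omega> (e \<oplus> f) * ord_of_nat (Poly_Mapping.lookup (cnf a) e * Poly_Mapping.lookup (cnf b) f).
        e \<leftarrow> exponents (cnf a), f \<leftarrow> exponents (cnf b)] 0"

definition jacobsthal_mult :: "'a ordinal \<Rightarrow> 'a ordinal \<Rightarrow> 'a ordinal" (infixl \<open>\<times>\<^sub>J\<close> 70) where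
  "a \<times>\<^sub>J b = ord_rec 0 (\<lambda>_ x. x \<oplus> a) b"

text \<open>
  The suprema at limit stages run over all smaller ordinals, including \<open>0\<close>. For base \<open>0\<close> the
  powers are not monotone in the exponent: \<open>0 ^\<otimes> b\<close> is \<open>0\<close> for successors \<open>b\<close> and \<open>1\<close> otherwise.
  Similarly, an infinite natural product of limit length with a factor \<open>0\<close> need not be \<open>0\<close>: with
  \<open>f 0 = 1\<close> and \<open>f i = 0\<close> for \<open>i \<noteq> 0\<close>, the partial products \<open>1, 0, 0, 0, \<dots>\<close> of \<open>0 ^\<otimes> f i\<close> have
  supremum \<open>1\<close>, although \<open>\<Oplus>i<\<omega>. f i\<close> is \<open>1\<close> and \<open>0 ^\<otimes> 1\<close> is \<open>0\<close>.
\<close>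

definition sj_pow :: "'a ordinal \<Rightarrow> 'a ordinal \<Rightarrow> 'a ordinal" (infixr \<open>^\<otimes>\<close> 80) where
  "a ^\<otimes> b = ord_rec 1 (\<lambda>_ x. x \<otimes> a) b"

text \<open>
  A family indexed by the ordinals below \<open>c\<close> is a total function of which only the values at
  arguments below \<open>c\<close> are used.
\<close>

definition inf_nat_sum :: "'a ordinal \<Rightarrow> ('a ordinal \<Rightarrow> 'a ordinal) \<Rightarrow> 'a ordinal" where
  "inf_nat_sum c f = ord_rec 0 (\<lambda>i x. x \<oplus> f i) c"

definition inf_nat_prod :: "'a ordinal \<Rightarrow> ('a ordinal \<Rightarrow> 'a ordinal) \<Rightarrow> 'a ordinal" where
  "inf_nat_prod c f = ord_rec 1 (\<lambda>i x. x \<otimes> f i) c"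

syntax
  "_inf_nat_sum" :: "pttrn \<Rightarrow> 'a ordinal \<Rightarrow> 'a ordinal \<Rightarrow> 'a ordinal"
    (\<open>(3\<Oplus>_<_./ _)\<close> [0, 51, 10] 10)
  "_inf_nat_prod" :: "pttrn \<Rightarrow> 'a ordinal \<Rightarrow> 'a ordinal \<Rightarrow> 'a ordinal"
    (\<open>(3\<Otimes>_<_./ _)\<close> [0, 51, 10] 10)
translations
  "\<Oplus>i<c. x" \<rightleftharpoons> "CONST inf_nat_sum c (\<lambda>i. x)"
  "\<Otimes>i<c. x" \<rightleftharpoons> "CONST inf_nat_prod c (\<lambda>i. x)"

end

theory Submission
  imports Defs
begin

text \<open>
  Everything reduces to the law \<open>a ^\<otimes> (b \<oplus> c) = (a ^\<otimes> b) \<otimes> (a ^\<otimes> c)\<close> and to continuity of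
  \<open>a ^\<otimes> b\<close> in \<open>b\<close>. The law is proved by induction on \<open>b\<close> and \<open>c\<close>, and the only difficult case
  is that of two limits with \<open>a \<ge> 2\<close>. There \<open>b \<oplus> c\<close> is the supremum of the sums \<open>b' \<oplus> c\<close> and
  \<open>b \<oplus> c'\<close> with \<open>b' < b\<close> and \<open>c' < c\<close>. Natural multiplication lacks the corresponding property in
  general, but has it for powers of \<open>\<omega>\<close>, and \<open>a ^\<otimes> b\<close> and \<open>a ^\<otimes> c\<close> are powers of \<open>\<omega>\<close> because they
  are closed under doubling. No formula for their exponents is needed.
\<close>

section \<open>Normal functions\<close>

lemma less_osuc_iff: "x < osuc y \<longleftrightarrow> x \<le> y"
  by (metis less_osuc not_less osuc_le_iff le_less_trans)

lemma not_less_zero_ordinal [simp]: "\<not> x < (0 :: 'a ordinal)"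
  by (simp add: not_less)

lemma neq_zero_ordinal_iff: "x \<noteq> (0 :: 'a ordinal) \<longleftrightarrow> 0 < x"
  by (metis not_less_zero_ordinal neq_iff)

lemma le_zero_ordinal [simp]: "x \<le> (0 :: 'a ordinal) \<longleftrightarrow> x = 0"
  by (metis antisym zero_le_ordinal order_refl)

lemma ordinal_cases [case_names zero osuc limit]:
  obtains "b = 0" | d where "b = osuc d" | "limit_ord b"
  by (auto simp: limit_ord_def)

lemma ordinal_induct [case_names zero osuc limit]:
  assumes "P 0" "\<And>d. P d \<Longrightarrow> P (osuc d)"
    and "\<And>b. limit_ord b \<Longrightarrow> (\<And>d. d < b \<Longrightarrow> P d) \<Longrightarrow> P b"
  shows "P (b :: 'a ordinal)"
proof (induction b rule: less_induct)
  case (less b)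
  show ?case
    using assms less less_osuc by (cases b rule: ordinal_cases) auto
qed

lemma limit_ord_pos: "limit_ord b \<Longrightarrow> 0 < b"
  by (simp add: limit_ord_def neq_zero_ordinal_iff)

lemma limit_ord_osuc_less: "limit_ord b \<Longrightarrow> d < b \<Longrightarrow> osuc d < b"
  by (metis limit_ord_def le_less osuc_le_iff)

lemma limit_ordI: "0 < b \<Longrightarrow> (\<And>d. d < b \<Longrightarrow> osuc d < b) \<Longrightarrow> limit_ord b"
  unfolding limit_ord_def using less_osuc by blast

lemma le_SUP_lessThan:
  fixes f :: "'a ordinal \<Rightarrow> 'a ordinal"
  shows "d < b \<Longrightarrow> f d \<le> (SUP d\<in>{..<b}. f d)"
  by (intro cSUP_upper bdd_above_image_lessThan_ordinal) simp

lemma SUP_lessThan_le: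
  fixes f :: "'a ordinal \<Rightarrow> 'a ordinal"
  assumes "0 < b" "\<And>d. d < b \<Longrightarrow> f d \<le> u"
  shows "(SUP d\<in>{..<b}. f d) \<le> u"
  using assms by (intro cSUP_least) auto

lemma less_SUP_lessThan_iff:
  fixes f :: "'a ordinal \<Rightarrow> 'a ordinal"
  assumes "0 < b"
  shows "x < (SUP d\<in>{..<b}. f d) \<longleftrightarrow> (\<exists>d<b. x < f d)"
  using assms by (subst less_cSUP_iff) (auto intro: bdd_above_image_lessThan_ordinal)

text \<open>Together with \<open>strict_mono\<close> this describes the normal functions. Every
  operation built by \<open>ord_rec\<close> is continuous in its recursion argument, whatever its
  step function is.\<close>

definition continuous_ord :: "('a ordinal \<Rightarrow> 'a ordinal) \<Rightarrow> bool" where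
  "continuous_ord f \<longleftrightarrow> (\<forall>b. limit_ord b \<longrightarrow> f b = (SUP d\<in>{..<b}. f d))"

lemma continuous_ord_rec: "continuous_ord (ord_rec z s)"
  by (simp add: continuous_ord_def ord_rec_limit)

text \<open>Only successor steps need checking, since a limit value is a supremum and so dominates
  the earlier values.\<close>

lemma mono_continuous_ord:
  assumes "continuous_ord f" "\<And>d. f d \<le> f (osuc d)"
  shows "mono f"
proof (rule monoI)
  fix b c :: "'a ordinal"
  show "b \<le> c \<Longrightarrow> f b \<le> f c"
  proof (induction c rule: ordinal_induct)
    case (osuc d)
    then show ?case
      using assms(2)[of d] by (metis le_less less_osuc_iff order_trans)
  next
    case (limit c)
    then show ?case
      using assms(1) le_SUP_lessThan[of b c f] by (auto simp: continuous_ord_def le_less)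
  qed simp
qed

lemma strict_mono_continuous_ord:
  assumes "continuous_ord f" "\<And>d. f d < f (osuc d)"
  shows "strict_mono f"
proof (rule strict_monoI)
  fix b c :: "'a ordinal"
  assume "b < c"
  have "mono f"
    using assms by (simp add: mono_continuous_ord less_imp_le)
  then have "f (osuc b) \<le> f c"
    using \<open>b < c\<close> by (simp add: osuc_le_iff monoD)
  then show "f b < f c"
    using assms(2) by (rule less_le_trans[rotated])
qed

text \<open>If \<open>f x < x\<close>, then \<open>f (f x) < f x\<close>, so \<open>f x\<close>
  would be a smaller counterexample.\<close>

lemma strict_mono_ordinal_le:
  fixes f :: "'a ordinal \<Rightarrow> 'a ordinal"
  assumes "strict_mono f"
  shows "x \<le> f x"
proof (induction x rule: less_induct)
  case (less x)
  show ?case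
  proof (rule ccontr)
    assume "\<not> x \<le> f x"
    then show False
      using less[of "f x"] strict_monoD[OF assms, of "f x" x] by (auto simp: not_le)
  qed
qed

text \<open>The least \<open>c\<close> with \<open>x < f c\<close> is not 0 by assumption and not a
  limit by continuity, so it is the successor of the required \<open>e\<close>. This floor serves
  for subtraction and for finding leading exponents.\<close>

lemma normal_floor:
  assumes "continuous_ord f" "strict_mono f" "f 0 \<le> x"
  obtains e where "f e \<le> x" "x < f (osuc e)"
proof -
  define c where "c = (LEAST c. x < f c)"
  have "x < f (osuc x)"
    using strict_mono_ordinal_le[OF assms(2), of x] strict_monoD[OF assms(2) less_osuc]
    by (rule le_less_trans)
  then have c: "x < f c" "\<And>d. d < c \<Longrightarrow> f d \<le> x"
    unfolding c_def using LeastI[of "\<lambda>c. x < f c"] not_less_Least[of _ "\<lambda>c. x < f c"]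
    by (auto simp: not_less)
  show ?thesis
  proof (cases c rule: ordinal_cases)
    case zero
    then show ?thesis
      using c assms(3) by simp
  next
    case (osuc d)
    then show ?thesis
      using c that less_osuc by blast
  next
    case limit
    then have "f c \<le> x"
      using assms(1) c(2) SUP_lessThan_le[of c f x]
      by (simp add: continuous_ord_def limit_ord_pos)
    then show ?thesis
      using c(1) by simp
  qed
qed


section \<open>Ordinary ordinal arithmetic\<close>

lemma add_zero_ordinal [simp]: "a + 0 = (a :: 'a ordinal)"
  by (simp add: plus_ordinal_def ord_rec_0)

lemma add_osuc: "a + osuc b = osuc (a + b)"
  by (simp add: plus_ordinal_def ord_rec_osuc)

lemma continuous_ord_add: "continuous_ord ((+) a)"
  unfolding plus_ordinal_def by (rule continuous_ord_rec)

lemma strict_mono_add_ordinal: "strict_mono ((+) (a :: 'a ordinal))"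
  by (rule strict_mono_continuous_ord[OF continuous_ord_add]) (simp add: add_osuc less_osuc)

lemma add_less_ordinal_iff [simp]: "a + b < a + c \<longleftrightarrow> b < (c :: 'a ordinal)"
  by (rule strict_mono_less[OF strict_mono_add_ordinal])

lemma le_add_ordinal: "a \<le> a + (b :: 'a ordinal)"
  using strict_mono_less_eq[OF strict_mono_add_ordinal, of a 0 b] by simp

lemma zero_add_ordinal [simp]: "0 + a = (a :: 'a ordinal)"
proof (induction a rule: ordinal_induct)
  case (limit b)
  have "0 + b = (SUP d\<in>{..<b}. 0 + d)"
    using continuous_ord_add limit(1) by (auto simp: continuous_ord_def)
  also have "\<dots> = b"
  proof (rule antisym)
    show "(SUP d\<in>{..<b}. 0 + d) \<le> b"
      using limit by (intro SUP_lessThan_le) (auto simp: limit_ord_pos)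
    show "b \<le> (SUP d\<in>{..<b}. 0 + d)"
      using limit less_SUP_lessThan_iff[of b _ "(+) 0"] limit_ord_osuc_less[OF limit(1)]
      by (metis less_irrefl less_osuc limit_ord_pos not_less)
  qed
  finally show ?case .
qed (simp_all add: add_osuc)

text \<open>The difference is the floor of \<open>b\<close> under the normal function
  \<open>(+) a\<close>.\<close>

lemma le_imp_ex_add_ordinal:
  assumes "a \<le> (b :: 'a ordinal)"
  obtains c where "b = a + c"
proof -
  obtain c where "a + c \<le> b" "b < a + osuc c"
    using assms by (auto intro: normal_floor[OF continuous_ord_add strict_mono_add_ordinal, of a b])
  then show ?thesis
    using that by (auto simp: add_osuc less_osuc_iff)
qed

section \<open>Finite ordinals, \<omega> and multiplication\<close>

lemma ord_of_nat_0 [simp]: "ord_of_nat 0 = 0"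
  by (simp add: ord_of_nat_def)

lemma ord_of_nat_Suc: "ord_of_nat (Suc n) = osuc (ord_of_nat n)"
  by (simp add: ord_of_nat_def)

lemma less_omega_iff: "x < \<omega> \<longleftrightarrow> (\<exists>n. x = ord_of_nat n)"
proof
  assume "x < \<omega>"
  then obtain n where "x < ord_of_nat n"
    unfolding omega_def by (subst (asm) less_cSUP_iff) (auto intro: bdd_above_range_nat_ordinal)
  then show "\<exists>n. x = ord_of_nat n"
    by (induction n) (auto simp: ord_of_nat_Suc less_osuc_iff le_less)
next
  assume "\<exists>n. x = ord_of_nat n"
  then obtain n where "x = ord_of_nat n" ..
  moreover have "ord_of_nat n < ord_of_nat (Suc n)"
    by (simp add: ord_of_nat_Suc less_osuc)
  ultimately show "x < \<omega>"
    unfolding omega_def by (subst less_cSUP_iff) (auto intro: bdd_above_range_nat_ordinal)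
qed

lemma limit_ord_omega: "limit_ord \<omega>"
proof (rule limit_ordI)
  show "0 < (\<omega> :: 'a ordinal)"
    unfolding less_omega_iff by (metis ord_of_nat_0)
  show "osuc d < \<omega>" if "d < \<omega>" for d :: "'a ordinal"
    using that unfolding less_omega_iff by (metis ord_of_nat_Suc)
qed

lemma omega_le_limit_ord:
  assumes "limit_ord b"
  shows "\<omega> \<le> b"
proof -
  have "ord_of_nat n < b" for n
    by (induction n) (use assms in \<open>auto simp: ord_of_nat_Suc limit_ord_pos limit_ord_osuc_less\<close>)
  then show ?thesis
    by (metis less_irrefl less_omega_iff not_less)
qed

lemma mult_zero_ordinal [simp]: "a * 0 = (0 :: 'a ordinal)"
  by (simp add: times_ordinal_def ord_rec_0)

lemma mult_osuc: "a * osuc b = a * b + a"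
  by (simp add: times_ordinal_def ord_rec_osuc)

lemma mult_one_ordinal [simp]: "a * 1 = (a :: 'a ordinal)"
  by (simp add: one_ordinal_def mult_osuc)

lemma continuous_ord_mult: "continuous_ord ((*) a)"
  unfolding times_ordinal_def by (rule continuous_ord_rec)

lemma strict_mono_mult_ordinal: "0 < a \<Longrightarrow> strict_mono ((*) (a :: 'a ordinal))"
  by (rule strict_mono_continuous_ord[OF continuous_ord_mult])
    (metis add_less_ordinal_iff add_zero_ordinal mult_osuc)

lemma less_mult_omega:
  assumes "x < a * \<omega>"
  obtains n where "x < a * ord_of_nat n"
proof -
  have "a * \<omega> = (SUP d\<in>{..<\<omega>}. a * d)"
    using continuous_ord_mult limit_ord_omega by (auto simp: continuous_ord_def)
  then show ?thesis
    using assms that less_SUP_lessThan_iff[OF limit_ord_pos[OF limit_ord_omega]]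
    by (metis less_omega_iff)
qed

lemma mult_ord_of_nat_mono: "m \<le> n \<Longrightarrow> a * ord_of_nat m \<le> a * ord_of_nat n"
  by (rule lift_Suc_mono_le[of "\<lambda>n. a * ord_of_nat n"])
    (auto simp: ord_of_nat_Suc mult_osuc le_add_ordinal)

section \<open>Powers of \<omega>\<close>

lemma opow_osuc: "opow a (osuc b) = opow a b * a"
  by (simp add: opow_def ord_rec_osuc)

lemma continuous_ord_opow: "continuous_ord (opow a)"
  unfolding opow_def[abs_def] by (rule continuous_ord_rec)

lemma opow_zero [simp]: "opow a 0 = 1"
  by (simp add: opow_def ord_rec_0)

lemma opow_omega_pos: "0 < opow \<omega> e"
proof (induction e rule: ordinal_induct)
  case zero
  then show ?case
    by (simp add: one_ordinal_def less_osuc)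
next
  case (osuc d)
  then show ?case
    using strict_monoD[OF strict_mono_mult_ordinal[OF osuc] limit_ord_pos[OF limit_ord_omega]]
    by (simp add: opow_osuc)
next
  case (limit b)
  then show ?case
    using continuous_ord_opow limit_ord_pos[of b] less_SUP_lessThan_iff[of b 0 "opow \<omega>"]
    unfolding continuous_ord_def by metis
qed

lemma strict_mono_opow_omega: "strict_mono (opow \<omega>)"
proof (rule strict_mono_continuous_ord[OF continuous_ord_opow])
  fix d :: "'a ordinal"
  have "1 < (\<omega> :: 'a ordinal)"
    using limit_ord_osuc_less[OF limit_ord_omega limit_ord_pos[OF limit_ord_omega]]
    by (simp add: one_ordinal_def)
  then have "opow \<omega> d * 1 < opow \<omega> d * \<omega>"
    by (rule strict_monoD[OF strict_mono_mult_ordinal[OF opow_omega_pos]])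
  then show "opow \<omega> d < opow \<omega> (osuc d)"
    by (simp add: opow_osuc)
qed

lemma opow_omega_mult_less: "e < f \<Longrightarrow> opow \<omega> e * ord_of_nat n < opow \<omega> f"
proof -
  assume "e < f"
  have "opow \<omega> e * ord_of_nat n < opow \<omega> e * \<omega>"
    by (rule strict_monoD[OF strict_mono_mult_ordinal[OF opow_omega_pos]]) (auto simp: less_omega_iff)
  also have "\<dots> \<le> opow \<omega> f"
    using \<open>e < f\<close> strict_mono_less_eq[OF strict_mono_opow_omega, of "osuc e" f]
    by (simp add: osuc_le_iff opow_osuc)
  finally show ?thesis .
qed


section \<open>Cantor normal form\<close>

text \<open>
  Coefficient families are compared at the largest exponent where they differ, whereas
  the order instance of \<open>poly_mapping\<close> compares them at the smallest one.
\<close>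

definition lex_less :: "('a ordinal \<Rightarrow>\<^sub>0 nat) \<Rightarrow> ('a ordinal \<Rightarrow>\<^sub>0 nat) \<Rightarrow> bool" where
  "lex_less p q \<longleftrightarrow> (\<exists>e. Poly_Mapping.lookup p e < Poly_Mapping.lookup q e \<and>
    (\<forall>k>e. Poly_Mapping.lookup p k = Poly_Mapping.lookup q k))"

text \<open>Distinct families differ at only finitely many exponents, and the largest of these
  decides.\<close>

lemma lex_less_linear: "p = q \<or> lex_less p q \<or> lex_less q p"
proof (cases "p = q")
  case False
  define D where "D = {k. Poly_Mapping.lookup p k \<noteq> Poly_Mapping.lookup q k}"
  have "D \<subseteq> Poly_Mapping.keys p \<union> Poly_Mapping.keys q"
    by (auto simp: D_def in_keys_iff)
  then have fin: "finite D"
    by (rule finite_subset) simp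
  have "D \<noteq> {}"
    using False by (auto simp: D_def intro: poly_mapping_eqI)
  then have "Poly_Mapping.lookup p (Max D) \<noteq> Poly_Mapping.lookup q (Max D)"
    using Max_in[OF fin] by (simp add: D_def)
  moreover have "Poly_Mapping.lookup p k = Poly_Mapping.lookup q k" if "Max D < k" for k
    using Max_ge[OF fin, of k] that unfolding D_def by fastforce
  ultimately show ?thesis
    unfolding lex_less_def by (metis neq_iff)
qed simp

text \<open>\<open>e\<close> only has to bound the support, and its coefficient may be 0. This
  allows splitting a family at the leading exponent of another one.\<close>

lemma poly_mapping_split_top:
  fixes p :: "'a ordinal \<Rightarrow>\<^sub>0 nat"
  assumes "\<forall>k\<in>Poly_Mapping.keys p. k \<le> e"
  obtains q where "p = Poly_Mapping.single e (Poly_Mapping.lookup p e) + q"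
    "\<forall>k\<in>Poly_Mapping.keys q. k < e" "Poly_Mapping.keys q = Poly_Mapping.keys p - {e}"
proof -
  define q where "q = Poly_Mapping.update e 0 p"
  have q: "Poly_Mapping.lookup q k = (if k = e then 0 else Poly_Mapping.lookup p k)" for k
    by (simp add: q_def lookup_update)
  have "p = Poly_Mapping.single e (Poly_Mapping.lookup p e) + q"
    by (rule poly_mapping_eqI) (auto simp: lookup_add q lookup_single when_def)
  moreover have keys: "Poly_Mapping.keys q = Poly_Mapping.keys p - {e}"
    by (auto simp: in_keys_iff q split: if_splits)
  ultimately show ?thesis
    using that assms by (auto simp: le_less)
qed

text \<open>Induction on the size of the support, with the leading term added last.\<close>

lemma poly_mapping_top_induct [case_names zero add]:
  fixes p :: "'a ordinal \<Rightarrow>\<^sub>0 nat"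
  assumes "P 0"
    and "\<And>e n q. 0 < n \<Longrightarrow> (\<forall>k\<in>Poly_Mapping.keys q. k < e) \<Longrightarrow> P q \<Longrightarrow>
      P (Poly_Mapping.single e n + q)"
  shows "P p"
proof (induction "card (Poly_Mapping.keys p)" arbitrary: p rule: less_induct)
  case less
  show ?case
  proof (cases "p = 0")
    case False
    define e where "e = Max (Poly_Mapping.keys p)"
    have e: "e \<in> Poly_Mapping.keys p" "\<forall>k\<in>Poly_Mapping.keys p. k \<le> e"
      using False by (auto simp: e_def)
    then obtain q where q: "p = Poly_Mapping.single e (Poly_Mapping.lookup p e) + q"
      "\<forall>k\<in>Poly_Mapping.keys q. k < e" "Poly_Mapping.keys q = Poly_Mapping.keys p - {e}"
      using poly_mapping_split_top by blast
    have "P q"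
      using q(3) e(1) by (intro less) (simp only: finite_keys card_Diff1_less)
    then show ?thesis
      using assms(2)[of "Poly_Mapping.lookup p e" q e] q e by (auto simp: in_keys_iff)
  qed (simp add: assms(1))
qed

lemma lookup_single_add_below:
  fixes q :: "'a ordinal \<Rightarrow>\<^sub>0 nat"
  assumes "\<forall>k\<in>Poly_Mapping.keys q. k < e"
  shows "Poly_Mapping.lookup (Poly_Mapping.single e n + q) k = (if k = e then n else Poly_Mapping.lookup q k)"
  using assms by (auto simp: lookup_add lookup_single when_def in_keys_iff)

section \<open>Evaluation of Cantor normal forms\<close>

lemma cnf_value_0 [simp]: "cnf_value 0 = 0"
  by (simp add: cnf_value_def exponents_def)

text \<open>Since \<open>exponents\<close> is decreasing, a new largest exponent \<open>e\<close>
  goes to the head of the list and leaves the fold over \<open>q\<close> unchanged.\<close>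

lemma cnf_value_single_add:
  assumes "\<forall>k\<in>Poly_Mapping.keys q. k < e"
  shows "cnf_value (Poly_Mapping.single e n + q) = opow \<omega> e * ord_of_nat n + cnf_value q"
proof (cases "n = 0")
  case False
  let ?p = "Poly_Mapping.single e n + q"
  note lookup_p = lookup_single_add_below[of q e n, OF assms]
  have "Poly_Mapping.keys ?p = insert e (Poly_Mapping.keys q)"
    using False by (auto simp: in_keys_iff lookup_p split: if_splits)
  moreover have "sorted_list_of_set (insert e (Poly_Mapping.keys q)) =
      sorted_list_of_set (Poly_Mapping.keys q) @ [e]"
    using assms by (intro sorted_distinct_set_unique) 
      (auto simp: sorted_append less_imp_le simp del: sorted_list_of_set.sorted_key_list_of_set_insert_remove)
  ultimately have ex: "exponents ?p = e # exponents q"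
    by (simp add: exponents_def)
  have "foldr (\<lambda>e x. opow \<omega> e * ord_of_nat (Poly_Mapping.lookup ?p e) + x) (exponents q) 0 = cnf_value q"
    unfolding cnf_value_def using assms
    by (intro foldr_cong) (auto simp: exponents_def lookup_p)
  then show ?thesis
    unfolding cnf_value_def[of ?p] ex using lookup_p[of e] by simp
qed simp

lemma cnf_value_single: "cnf_value (Poly_Mapping.single e n) = opow \<omega> e * ord_of_nat n"
  using cnf_value_single_add[of 0 e n] by simp

lemma cnf_value_less_opow:
  "\<forall>k\<in>Poly_Mapping.keys p. k < e \<Longrightarrow> cnf_value p < opow \<omega> e"
proof (induction p arbitrary: e rule: poly_mapping_top_induct)
  case (add f n q)
  have "f \<in> Poly_Mapping.keys (Poly_Mapping.single f n + q)"
    using add.hyps by (simp add: in_keys_iff lookup_single_add_below)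
  then have "f < e"
    using add.prems by blast
  have "cnf_value (Poly_Mapping.single f n + q) < opow \<omega> f * ord_of_nat n + opow \<omega> f"
    using add by (simp add: cnf_value_single_add)
  also have "\<dots> < opow \<omega> e"
    using opow_omega_mult_less[OF \<open>f < e\<close>, of "Suc n"] by (simp add: ord_of_nat_Suc mult_osuc)
  finally show ?case .
qed (simp add: opow_omega_pos)

text \<open>Both families are split at the leading exponent \<open>e\<close> of the larger one. If
  they differ there, the lower terms of \<open>p\<close> cannot make up for a missing copy of
  \<open>opow \<omega> e\<close>; otherwise the leading terms agree and the induction hypothesis
  applies to the remainders.\<close>

lemma cnf_value_strict_mono: "lex_less p q \<Longrightarrow> cnf_value p < cnf_value q"
proof (induction q arbitrary: p rule: poly_mapping_top_induct)
  case (add e n q)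
  let ?q = "Poly_Mapping.single e n + q"
  note lookup_q = lookup_single_add_below[of q e n, OF add.hyps(2)]
  obtain k where k: "Poly_Mapping.lookup p k < Poly_Mapping.lookup ?q k"
    "\<And>l. k < l \<Longrightarrow> Poly_Mapping.lookup p l = Poly_Mapping.lookup ?q l"
    using add.prems by (auto simp: lex_less_def)
  have "k \<le> e"
  proof (cases "k = e")
    case False
    then have "k \<in> Poly_Mapping.keys q"
      using k(1) by (simp add: lookup_q in_keys_iff)
    then show ?thesis
      using add.hyps(2) by fastforce
  qed simp
  have "l \<le> e" if "l \<in> Poly_Mapping.keys p" for l
  proof (rule ccontr)
    assume "\<not> l \<le> e"
    then have "l \<noteq> e" "l \<notin> Poly_Mapping.keys q" "k < l"
      using add.hyps(2) \<open>k \<le> e\<close> by (auto simp: not_le)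
    then show False
      using that k(2)[of l] by (simp add: lookup_q in_keys_iff)
  qed
  then have "\<forall>l\<in>Poly_Mapping.keys p. l \<le> e" ..
  then obtain p' where p': "p = Poly_Mapping.single e (Poly_Mapping.lookup p e) + p'"
    "\<forall>k\<in>Poly_Mapping.keys p'. k < e"
    using poly_mapping_split_top by blast
  note value_p = cnf_value_single_add[of p' e "Poly_Mapping.lookup p e", OF p'(2), folded p'(1)]
  note lookup_p = lookup_single_add_below[of p' e "Poly_Mapping.lookup p e", OF p'(2), folded p'(1)]
  note value_q = cnf_value_single_add[of q e n, OF add.hyps(2)]
  show ?case
  proof (cases "k = e")
    case True
    have "cnf_value p < opow \<omega> e * ord_of_nat (Suc (Poly_Mapping.lookup p e))"
      by (simp add: value_p ord_of_nat_Suc mult_osuc cnf_value_less_opow p'(2))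
    also have "\<dots> \<le> opow \<omega> e * ord_of_nat n"
      using k(1) True by (intro mult_ord_of_nat_mono) (simp add: lookup_q)
    also have "\<dots> \<le> cnf_value ?q"
      by (simp add: value_q le_add_ordinal)
    finally show ?thesis .
  next
    case False
    with \<open>k \<le> e\<close> have "k < e"
      by simp
    have "e \<notin> Poly_Mapping.keys q" "e \<notin> Poly_Mapping.keys p'"
      using p'(2) add.hyps(2) by auto
    then have "Poly_Mapping.lookup p' l = Poly_Mapping.lookup q l" if "k < l" for l
      using k(2)[OF that] \<open>e \<notin> Poly_Mapping.keys q\<close> \<open>e \<notin> Poly_Mapping.keys p'\<close> lookup_p[of l] lookup_q[of l]
      by (auto simp: in_keys_iff split: if_splits)
    moreover have "Poly_Mapping.lookup p' k < Poly_Mapping.lookup q k"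
      using k(1) False lookup_p[of k] by (simp add: lookup_q)
    ultimately have "cnf_value p' < cnf_value q"
      by (intro add.IH) (auto simp: lex_less_def)
    moreover have "Poly_Mapping.lookup p e = n"
      using k(2)[OF \<open>k < e\<close>] by (simp add: lookup_q)
    ultimately show ?thesis
      by (simp add: value_p value_q)
  qed
qed (simp add: lex_less_def)

lemma cnf_value_mono:
  assumes "\<And>k. Poly_Mapping.lookup p k \<le> Poly_Mapping.lookup q k"
  shows "cnf_value p \<le> cnf_value q"
proof -
  have "\<not> lex_less q p"
    using assms by (auto simp: lex_less_def not_less)
  then show ?thesis
    using lex_less_linear[of p q] cnf_value_strict_mono[of p q] by auto
qed

text \<open>Uniqueness of the Cantor normal form: distinct families are comparable and evaluation is
  strictly monotone.\<close>

lemma cnf_value_eq_iff: "cnf_value p = cnf_value q \<longleftrightarrow> p = q"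
  using lex_less_linear[of p q] cnf_value_strict_mono[of p q] cnf_value_strict_mono[of q p]
  by auto

lemma cnf_value_less_iff: "cnf_value p < cnf_value q \<longleftrightarrow> lex_less p q"
  using lex_less_linear[of p q] cnf_value_strict_mono[of p q] cnf_value_strict_mono[of q p]
  by auto

lemma opow_omega_le_cnf_value:
  assumes "k \<in> Poly_Mapping.keys p"
  shows "opow \<omega> k \<le> cnf_value p"
proof -
  have "opow \<omega> k = cnf_value (Poly_Mapping.single k 1)"
    by (simp add: cnf_value_single mult_osuc ord_of_nat_Suc)
  also have "\<dots> \<le> cnf_value p"
    using assms by (intro cnf_value_mono) (auto simp: lookup_single when_def in_keys_iff)
  finally show ?thesis .
qed

text \<open>Existence of the Cantor normal form: \<open>normal_floor\<close> yields the leading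
  exponent, continuity of multiplication its finite coefficient, and the remainder is smaller than
  \<open>x\<close>.\<close>

lemma ex_cnf_value: "\<exists>p. cnf_value p = x"
proof (induction x rule: less_induct)
  case (less x)
  show ?case
  proof (cases "x = 0")
    case False
    then have "opow \<omega> 0 \<le> x"
      by (simp add: one_ordinal_def osuc_le_iff neq_zero_ordinal_iff)
    then obtain e where e: "opow \<omega> e \<le> x" "x < opow \<omega> (osuc e)"
      by (rule normal_floor[OF continuous_ord_opow strict_mono_opow_omega])
    have "\<exists>n. x < opow \<omega> e * ord_of_nat n"
      using e(2) unfolding opow_osuc by (metis less_mult_omega)
    \<comment> \<open>\<open>m\<close> is one more than the leading coefficient \<open>n\<close>, so
      what remains after \<open>n\<close> copies is below one further copy.\<close>
    define m where "m = (LEAST n. x < opow \<omega> e * ord_of_nat n)"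
    have m: "x < opow \<omega> e * ord_of_nat m"
      unfolding m_def by (rule LeastI_ex) fact
    then obtain n where n: "m = Suc n"
      by (cases m) auto
    then have "opow \<omega> e * ord_of_nat n \<le> x"
      using not_less_Least[of n "\<lambda>n. x < opow \<omega> e * ord_of_nat n"] by (simp add: m_def not_less)
    then obtain r where r: "x = opow \<omega> e * ord_of_nat n + r"
      by (rule le_imp_ex_add_ordinal)
    have "r < opow \<omega> e"
      using m by (simp add: n r ord_of_nat_Suc mult_osuc)
    then obtain q where q: "cnf_value q = r"
      using less e(1) by (meson less_le_trans)
    have "k < e" if "k \<in> Poly_Mapping.keys q" for k
      using opow_omega_le_cnf_value[OF that] \<open>r < opow \<omega> e\<close>
        strict_mono_less[OF strict_mono_opow_omega, of k e] unfolding q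
      by (meson le_less_trans)
    then have "\<forall>k\<in>Poly_Mapping.keys q. k < e" ..
    then have "cnf_value (Poly_Mapping.single e n + q) = x"
      using q r by (simp add: cnf_value_single_add)
    then show ?thesis ..
  qed (use cnf_value_0 in blast)
qed

lemma cnf_cnf_value [simp]: "cnf (cnf_value p) = p"
  by (simp add: cnf_def cnf_value_eq_iff)

lemma cnf_value_cnf [simp]: "cnf_value (cnf a) = a"
  by (metis cnf_cnf_value ex_cnf_value)

lemma cnf_eq_iff: "cnf a = cnf b \<longleftrightarrow> a = b"
  by (metis cnf_value_cnf)

lemma less_iff_lex_less: "a < b \<longleftrightarrow> lex_less (cnf a) (cnf b)"
  by (metis cnf_value_cnf cnf_value_less_iff)

lemma cnf_0 [simp]: "cnf 0 = 0"
  by (metis cnf_cnf_value cnf_value_0)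

lemma less_opow_omega_iff: "a < opow \<omega> e \<longleftrightarrow> (\<forall>k\<in>Poly_Mapping.keys (cnf a). k < e)"
proof
  assume "a < opow \<omega> e"
  then show "\<forall>k\<in>Poly_Mapping.keys (cnf a). k < e"
    using opow_omega_le_cnf_value[of _ "cnf a"] strict_mono_less[OF strict_mono_opow_omega]
    by (metis cnf_value_cnf le_less_trans)
next
  assume "\<forall>k\<in>Poly_Mapping.keys (cnf a). k < e"
  then show "a < opow \<omega> e"
    using cnf_value_less_opow[of "cnf a" e] by simp
qed

lemma cnf_opow_omega_mult: "cnf (opow \<omega> e * ord_of_nat n) = Poly_Mapping.single e n"
  by (metis cnf_cnf_value cnf_value_single)

lemma ord_of_nat_1: "ord_of_nat (Suc 0) = 1"
  by (simp add: ord_of_nat_Suc one_ordinal_def)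

lemma cnf_opow_omega: "cnf (opow \<omega> e) = Poly_Mapping.single e 1"
  using cnf_opow_omega_mult[of e 1] by (simp add: ord_of_nat_1)


section \<open>Natural sum and product\<close>

lemma cnf_nat_sum [simp]: "cnf (a \<oplus> b) = cnf a + cnf b"
  by (simp add: nat_sum_def)

lemma nat_sum_commute: "a \<oplus> b = b \<oplus> a"
  by (simp add: nat_sum_def add.commute)

lemma nat_sum_assoc: "(a \<oplus> b) \<oplus> c = a \<oplus> (b \<oplus> c)"
  by (simp add: nat_sum_def add.assoc)

lemma nat_sum_0 [simp]: "a \<oplus> 0 = a" "0 \<oplus> a = a"
  by (simp_all add: nat_sum_def)

text \<open>Adding a common summand leaves the largest differing exponent, and the direction of the
  difference there, unchanged.\<close>

lemma nat_sum_less_right_iff [simp]: "a \<oplus> c < b \<oplus> c \<longleftrightarrow> a < b"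
  by (simp add: less_iff_lex_less[of a b] less_iff_lex_less[of "a \<oplus> c" "b \<oplus> c"] lex_less_def lookup_add)

lemma nat_sum_less_left_iff [simp]: "c \<oplus> a < c \<oplus> b \<longleftrightarrow> a < b"
  by (simp add: less_iff_lex_less[of a b] less_iff_lex_less[of "c \<oplus> a" "c \<oplus> b"] lex_less_def lookup_add)

lemma nat_sum_le_right_iff [simp]: "a \<oplus> c \<le> b \<oplus> c \<longleftrightarrow> a \<le> b"
  by (metis nat_sum_less_right_iff not_less)

lemma nat_sum_le_left_iff [simp]: "c \<oplus> a \<le> c \<oplus> b \<longleftrightarrow> a \<le> b"
  by (metis nat_sum_less_left_iff not_less)

lemma nat_sum_mono: "a \<le> b \<Longrightarrow> c \<le> d \<Longrightarrow> a \<oplus> c \<le> b \<oplus> d"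
  by (meson nat_sum_le_left_iff nat_sum_le_right_iff order_trans)

lemma le_nat_sum: "a \<le> a \<oplus> b" "a \<le> b \<oplus> a"
  using nat_sum_le_left_iff[of a 0 b] nat_sum_le_right_iff[of 0 a b] by simp_all

text \<open>
  If \<open>e\<close> is the largest exponent at which \<open>c\<close> and \<open>a \<oplus> b\<close> differ, lower a positive coefficient
  of \<open>a\<close> or \<open>b\<close> at \<open>e\<close> by one and copy the coefficients of \<open>c\<close> below \<open>e\<close>.
\<close>

lemma less_nat_sum_cases:
  assumes "c < a \<oplus> b"
  obtains a' where "a' < a" "c \<le> a' \<oplus> b" | b' where "b' < b" "c \<le> a \<oplus> b'"
proof -
  obtain e where e: "Poly_Mapping.lookup (cnf c) e <
      Poly_Mapping.lookup (cnf a) e + Poly_Mapping.lookup (cnf b) e"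
    "\<And>k. e < k \<Longrightarrow> Poly_Mapping.lookup (cnf c) k =
      Poly_Mapping.lookup (cnf a) k + Poly_Mapping.lookup (cnf b) k"
    using assms unfolding less_iff_lex_less[of c] by (auto simp: lex_less_def lookup_add)
  have *: "\<exists>x'<x. c \<le> x' \<oplus> y"
    if x: "0 < Poly_Mapping.lookup (cnf x) e"
      and xy: "Poly_Mapping.lookup (cnf c) e <
        Poly_Mapping.lookup (cnf x) e + Poly_Mapping.lookup (cnf y) e"
      "\<And>k. e < k \<Longrightarrow> Poly_Mapping.lookup (cnf c) k =
        Poly_Mapping.lookup (cnf x) k + Poly_Mapping.lookup (cnf y) k"
    for x y :: "'a ordinal"
  proof -
    define g where "g k = (if k < e then Poly_Mapping.lookup (cnf c) k
      else Poly_Mapping.lookup (cnf x) k - (if k = e then 1 else 0))" for k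
    have "{k. g k \<noteq> 0} \<subseteq> Poly_Mapping.keys (cnf c) \<union> Poly_Mapping.keys (cnf x)"
      by (auto simp: g_def in_keys_iff)
    then have "finite {k. g k \<noteq> 0}"
      by (rule finite_subset) simp
    then obtain p where "Poly_Mapping.lookup p = g"
      by (metis lookup_Abs_poly_mapping)
    then obtain x' where x': "Poly_Mapping.lookup (cnf x') = g"
      by (metis cnf_cnf_value)
    have "x' < x"
      unfolding less_iff_lex_less[of x'] lex_less_def x' using x by (intro exI[of _ e]) (auto simp: g_def)
    moreover have "cnf_value (cnf c) \<le> cnf_value (cnf (x' \<oplus> y))"
      using xy by (intro cnf_value_mono) (auto simp: lookup_add x' g_def neq_iff)
    ultimately show ?thesis
      unfolding cnf_value_cnf by blast
  qed
  show ?thesis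
  proof (cases "0 < Poly_Mapping.lookup (cnf a) e")
    case True
    then show ?thesis
      using *[of a b] e that(1) by blast
  next
    case False
    then show ?thesis
      using *[of b a] e that(2) by (auto simp: add.commute nat_sum_commute)
  qed
qed

lemma osuc_nat_sum_le: "osuc (a \<oplus> b) \<le> a \<oplus> osuc b"
  by (simp add: osuc_le_iff less_osuc)

text \<open>If the right side were smaller, \<open>less_nat_sum_cases\<close> would bound it by
  \<open>a' \<oplus> osuc b\<close> with \<open>a' < a\<close>, which the induction hypothesis turns
  into \<open>osuc (a' \<oplus> b)\<close>, or by \<open>a \<oplus> b'\<close> with
  \<open>b' \<le> b\<close>. Both are too small.\<close>

lemma nat_sum_osuc: "a \<oplus> osuc b = osuc (a \<oplus> b)"
proof (induction a rule: less_induct)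
  case (less a)
  have "\<not> osuc (a \<oplus> b) < a \<oplus> osuc b"
  proof
    assume "osuc (a \<oplus> b) < a \<oplus> osuc b"
    then show False
    proof (cases rule: less_nat_sum_cases)
      case (1 a')
      then show ?thesis
        using less by (metis not_less nat_sum_less_right_iff osuc_le_iff less_osuc_iff)
    next
      case (2 b')
      then show ?thesis
        by (metis less_osuc_iff nat_sum_le_left_iff not_less osuc_le_iff)
    qed
  qed
  then show ?case
    using osuc_nat_sum_le[of a b] by simp
qed

lemma osuc_nat_sum: "osuc a \<oplus> b = osuc (a \<oplus> b)"
  using nat_sum_osuc[of b a] by (simp add: nat_sum_commute)

lemma nat_sum_one: "a \<oplus> 1 = osuc a"
  by (simp add: one_ordinal_def nat_sum_osuc)

text \<open>Anything below the sum is bounded by a sum with one argument lowered, and that argument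
  can still be raised by one.\<close>

lemma limit_ord_nat_sum:
  assumes "limit_ord a" "b = 0 \<or> limit_ord b"
  shows "limit_ord (a \<oplus> b)"
proof (rule limit_ordI)
  show "0 < a \<oplus> b"
    using limit_ord_pos[OF assms(1)] le_nat_sum(1) by (rule less_le_trans)
  show "osuc c < a \<oplus> b" if "c < a \<oplus> b" for c
    using that
  proof (cases rule: less_nat_sum_cases)
    case (1 a')
    then have "osuc c \<le> osuc a' \<oplus> b"
      by (simp add: osuc_nat_sum osuc_le_iff less_osuc_iff)
    then show ?thesis
      using limit_ord_osuc_less[OF assms(1) 1(1)] by (meson le_less_trans nat_sum_less_right_iff)
  next
    case (2 b')
    then have "limit_ord b"
      using assms(2) by auto
    have "osuc c \<le> a \<oplus> osuc b'"
      using 2 by (simp add: nat_sum_osuc osuc_le_iff less_osuc_iff)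
    then show ?thesis
      using limit_ord_osuc_less[OF \<open>limit_ord b\<close> 2(1)] by (meson le_less_trans nat_sum_less_left_iff)
  qed
qed

text \<open>The powers of \<omega> generate all ordinals under \<oplus>, so identities for \<otimes>
  that are additive in an argument need checking only at powers of \<omega>.\<close>

lemma nat_sum_induct [case_names zero opow sum]:
  assumes "P 0" "\<And>e. P (opow \<omega> e)" "\<And>a b. P a \<Longrightarrow> P b \<Longrightarrow> P (a \<oplus> b)"
  shows "P a"
proof -
  have "P (cnf_value p)" for p
  proof (induction p rule: poly_mapping_top_induct)
    case (add e n q)
    have "P (cnf_value (Poly_Mapping.single e m))" for m
    proof (induction m)
      case (Suc m)
      have "cnf_value (Poly_Mapping.single e (Suc m)) =
          opow \<omega> e \<oplus> cnf_value (Poly_Mapping.single e m)"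
        by (simp add: nat_sum_def cnf_opow_omega flip: single_add)
      then show ?case
        using assms(2,3) Suc by simp
    qed (simp add: assms(1))
    moreover have "cnf_value (Poly_Mapping.single e n + q) =
        cnf_value (Poly_Mapping.single e n) \<oplus> cnf_value q"
      by (simp add: nat_sum_def)
    ultimately show ?case
      using assms(3) add by simp
  qed (simp add: assms(1))
  then show ?thesis
    by (metis cnf_value_cnf)
qed

text \<open>Replacing the list fold by a double finite sum of coefficient families turns algebraic
  laws of \<otimes> into rearrangements of sums.\<close>

lemma cnf_nat_prod:
  "cnf (a \<otimes> b) = (\<Sum>e\<in>Poly_Mapping.keys (cnf a). \<Sum>f\<in>Poly_Mapping.keys (cnf b).
     Poly_Mapping.single (e \<oplus> f) (Poly_Mapping.lookup (cnf a) e * Poly_Mapping.lookup (cnf b) f))"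
proof -
  have foldr: "cnf (foldr (\<oplus>) xs 0) = sum_list (map cnf xs)" for xs :: "'a ordinal list"
    by (induction xs) simp_all
  have concat: "sum_list (concat xss) = sum_list (map sum_list xss)"
    for xss :: "('a ordinal \<Rightarrow>\<^sub>0 nat) list list"
    by (induction xss) simp_all
  have exponents: "sum_list (map h (exponents p)) = sum h (Poly_Mapping.keys p)"
    for h :: "'a ordinal \<Rightarrow> 'a ordinal \<Rightarrow>\<^sub>0 nat" and p :: "'a ordinal \<Rightarrow>\<^sub>0 nat"
    by (subst sum_list_distinct_conv_sum_set) (simp_all add: exponents_def)
  show ?thesis
    by (simp add: nat_prod_def foldr map_concat concat comp_def exponents cnf_opow_omega_mult)
qed

lemma nat_prod_commute: "a \<otimes> b = b \<otimes> a"
proof -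
  have "cnf (a \<otimes> b) = cnf (b \<otimes> a)"
    unfolding cnf_nat_prod by (subst sum.swap) (simp add: nat_sum_commute mult.commute)
  then show ?thesis
    by (simp add: cnf_eq_iff)
qed

text \<open>The range of summation changes with the support of the sum, but the summand is additive
  in the coefficient and vanishes at 0.\<close>

lemma nat_prod_distrib_right: "(a \<oplus> b) \<otimes> c = (a \<otimes> c) \<oplus> (b \<otimes> c)"
proof -
  have "cnf ((a \<oplus> b) \<otimes> c) = cnf ((a \<otimes> c) \<oplus> (b \<otimes> c))"
    unfolding cnf_nat_prod cnf_nat_sum
    by (rule setsum_keys_plus_distrib) (simp_all add: add_mult_distrib single_add sum.distrib)
  then show ?thesis
    by (simp only: cnf_eq_iff)
qed

lemma nat_prod_distrib_left: "c \<otimes> (a \<oplus> b) = (c \<otimes> a) \<oplus> (c \<otimes> b)"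
  using nat_prod_distrib_right[of a b c] by (simp add: nat_prod_commute)

lemma nat_prod_0 [simp]: "a \<otimes> 0 = 0" "0 \<otimes> a = 0"
proof -
  have "cnf (a \<otimes> 0) = cnf 0"
    unfolding cnf_nat_prod by simp
  then show "a \<otimes> 0 = 0"
    by (simp only: cnf_eq_iff)
  then show "0 \<otimes> a = 0"
    by (simp add: nat_prod_commute)
qed

lemma nat_prod_opow_omega: "opow \<omega> e \<otimes> opow \<omega> f = opow \<omega> (e \<oplus> f)"
proof -
  have "cnf (opow \<omega> e \<otimes> opow \<omega> f) = cnf (opow \<omega> (e \<oplus> f))"
    unfolding cnf_nat_prod by (simp add: cnf_opow_omega)
  then show ?thesis
    by (simp add: cnf_eq_iff)
qed

text \<open>Both sides are additive in each argument, and at powers of \<omega> the claim is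
  associativity of \<oplus> in the exponents.\<close>

lemma nat_prod_assoc: "(a \<otimes> b) \<otimes> c = a \<otimes> (b \<otimes> c)"
proof (induction a rule: nat_sum_induct)
  case (opow e)
  show ?case
  proof (induction b rule: nat_sum_induct)
    case (opow f)
    show ?case
      by (induction c rule: nat_sum_induct)
        (simp_all add: nat_prod_opow_omega nat_sum_assoc nat_prod_distrib_left)
  qed (simp_all add: nat_prod_distrib_left nat_prod_distrib_right)
qed (simp_all add: nat_prod_distrib_right)

lemma nat_prod_1 [simp]: "a \<otimes> 1 = a" "1 \<otimes> a = a"
proof -
  show "a \<otimes> 1 = a"
  proof (induction a rule: nat_sum_induct)
    case (opow e)
    show ?case
      using nat_prod_opow_omega[of e 0] by simp
  qed (simp_all add: nat_prod_distrib_right)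
  then show "1 \<otimes> a = a"
    by (simp add: nat_prod_commute)
qed

text \<open>Every exponent of the product is the natural sum of an exponent of \<open>a\<close>,
  below \<open>e\<close>, and one of \<open>b\<close>, at most \<open>f\<close>.\<close>

lemma nat_prod_less_opow_omega:
  assumes "a < opow \<omega> e" "\<And>k. k \<in> Poly_Mapping.keys (cnf b) \<Longrightarrow> k \<le> f"
  shows "a \<otimes> b < opow \<omega> (e \<oplus> f)"
  unfolding less_opow_omega_iff
proof
  fix k
  assume "k \<in> Poly_Mapping.keys (cnf (a \<otimes> b))"
  then have "Poly_Mapping.lookup (cnf (a \<otimes> b)) k \<noteq> 0"
    by (simp add: in_keys_iff)
  then obtain x y where xy: "x \<in> Poly_Mapping.keys (cnf a)" "y \<in> Poly_Mapping.keys (cnf b)"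
    "k = x \<oplus> y"
    unfolding cnf_nat_prod lookup_sum by (auto simp: lookup_single when_def split: if_splits)
  have "x \<oplus> y < e \<oplus> y"
    using xy(1) assms(1) by (simp add: less_opow_omega_iff)
  also have "\<dots> \<le> e \<oplus> f"
    using xy(2) assms(2) by simp
  finally show "k < e \<oplus> f"
    by (simp add: xy(3))
qed

text \<open>The coefficientwise bound makes the truncated subtraction of coefficients exact.\<close>

lemma nat_sum_exists:
  assumes "\<And>k. Poly_Mapping.lookup (cnf a) k \<le> Poly_Mapping.lookup (cnf b) k"
  obtains c where "b = a \<oplus> c" "cnf c = cnf b - cnf a"
proof
  have "cnf a + (cnf b - cnf a) = cnf b"
    using assms by (intro poly_mapping_eqI) (simp add: lookup_add lookup_minus)
  then show "b = a \<oplus> cnf_value (cnf b - cnf a)"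
    by (simp add: nat_sum_def)
qed simp

lemma less_ordinal_cnf_decompose:
  assumes "a < (b :: 'a ordinal)"
  obtains h l m e where "a = h \<oplus> l" "l < opow \<omega> e" "b = h \<oplus> (opow \<omega> e \<oplus> m)"
proof -
  obtain e where e: "Poly_Mapping.lookup (cnf a) e < Poly_Mapping.lookup (cnf b) e"
    "\<And>k. e < k \<Longrightarrow> Poly_Mapping.lookup (cnf a) k = Poly_Mapping.lookup (cnf b) k"
    using assms unfolding less_iff_lex_less[of a] by (auto simp: lex_less_def)
  \<comment> \<open>\<open>h\<close> keeps the terms of \<open>a\<close> with exponent at least
    \<open>e\<close>; \<open>b\<close> contains all of them and at least one more copy of
    \<open>opow \<omega> e\<close>.\<close>
  define g where "g k = (if k < e then 0 else Poly_Mapping.lookup (cnf a) k)" for k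
  have "{k. g k \<noteq> 0} \<subseteq> Poly_Mapping.keys (cnf a)"
    by (auto simp: g_def in_keys_iff)
  then have "finite {k. g k \<noteq> 0}"
    by (rule finite_subset) simp
  then obtain p where "Poly_Mapping.lookup p = g"
    by (metis lookup_Abs_poly_mapping)
  then obtain h where h: "Poly_Mapping.lookup (cnf h) = g"
    by (metis cnf_cnf_value)
  obtain l where l: "a = h \<oplus> l" "cnf l = cnf a - cnf h"
    by (rule nat_sum_exists[of h a]) (auto simp: h g_def)
  have "Poly_Mapping.lookup (cnf (h \<oplus> opow \<omega> e)) k \<le> Poly_Mapping.lookup (cnf b) k" for k
    using e by (auto simp: lookup_add h g_def cnf_opow_omega lookup_single when_def neq_iff)
  then obtain m where "b = (h \<oplus> opow \<omega> e) \<oplus> m"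
    by (rule nat_sum_exists)
  moreover have "l < opow \<omega> e"
    by (auto simp: less_opow_omega_iff l(2) in_keys_iff lookup_minus h g_def split: if_splits)
  ultimately show ?thesis
    using l(1) that by (simp add: nat_sum_assoc)
qed

text \<open>The common part \<open>h\<close> cancels. With \<open>f\<close> the leading exponent of
  \<open>c\<close>, the rest of \<open>a\<close> contributes less than
  \<open>opow \<omega> (e \<oplus> f)\<close>, while the extra \<open>opow \<omega> e\<close> in
  \<open>b\<close> contributes at least that much.\<close>

lemma nat_prod_strict_mono:
  assumes "a < b" "0 < c"
  shows "a \<otimes> c < b \<otimes> c"
proof -
  obtain h l m e where *: "a = h \<oplus> l" "l < opow \<omega> e" "b = h \<oplus> (opow \<omega> e \<oplus> m)"
    using assms(1) by (rule less_ordinal_cnf_decompose)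
  define f where "f = Max (Poly_Mapping.keys (cnf c))"
  have "cnf c \<noteq> 0"
    using assms(2) cnf_eq_iff[of c 0] by auto
  then have f: "f \<in> Poly_Mapping.keys (cnf c)" "\<And>k. k \<in> Poly_Mapping.keys (cnf c) \<Longrightarrow> k \<le> f"
    by (auto simp: f_def)
  have "Poly_Mapping.lookup (cnf (opow \<omega> f)) k \<le> Poly_Mapping.lookup (cnf c) k" for k
    using f(1) by (auto simp: cnf_opow_omega lookup_single when_def in_keys_iff)
  then obtain d where d: "c = opow \<omega> f \<oplus> d"
    by (rule nat_sum_exists)
  have "l \<otimes> c < opow \<omega> e \<otimes> opow \<omega> f"
    unfolding nat_prod_opow_omega by (rule nat_prod_less_opow_omega[OF *(2) f(2)])
  also have "\<dots> \<le> opow \<omega> e \<otimes> c"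
    unfolding d nat_prod_distrib_left by (rule le_nat_sum)
  also have "\<dots> \<le> (opow \<omega> e \<oplus> m) \<otimes> c"
    unfolding nat_prod_distrib_right by (rule le_nat_sum)
  finally show ?thesis
    by (simp add: * nat_prod_distrib_right)
qed

lemma nat_prod_mono_right: "a \<le> b \<Longrightarrow> a \<otimes> c \<le> b \<otimes> c"
  using nat_prod_strict_mono[of a b c] by (cases "c = 0") (auto simp: neq_zero_ordinal_iff le_less)

lemma nat_prod_mono_left: "a \<le> b \<Longrightarrow> c \<otimes> a \<le> c \<otimes> b"
  using nat_prod_mono_right[of a b c] by (simp add: nat_prod_commute)

text \<open>If \<open>b\<close> exceeded its leading power \<open>opow \<omega> e\<close>, repeated
  doubling would keep \<open>opow \<omega> e * ord_of_nat (2 ^ n)\<close> below \<open>b\<close> for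
  every \<open>n\<close>, contradicting the finite leading coefficient.\<close>

lemma eq_opow_omegaI:
  assumes "0 < b" "\<And>x. x < b \<Longrightarrow> x \<oplus> x < b"
  obtains e where "b = opow \<omega> e"
proof -
  define e where "e = Max (Poly_Mapping.keys (cnf b))"
  have "cnf b \<noteq> 0"
    using assms(1) cnf_eq_iff[of b 0] by auto
  then have e: "e \<in> Poly_Mapping.keys (cnf b)" "\<And>k. k \<in> Poly_Mapping.keys (cnf b) \<Longrightarrow> k \<le> e"
    by (auto simp: e_def)
  have "\<not> opow \<omega> e < b"
  proof
    assume less: "opow \<omega> e < b"
    have *: "opow \<omega> e * ord_of_nat (2 ^ n) < b" for n
    proof (induction n)
      case (Suc n)
      let ?x = "opow \<omega> e * ord_of_nat (2 ^ n) :: 'a ordinal"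
      have "cnf (?x \<oplus> ?x) = cnf (opow \<omega> e * ord_of_nat (2 ^ Suc n))"
        by (simp add: cnf_opow_omega_mult mult_2 flip: single_add)
      then have "?x \<oplus> ?x = opow \<omega> e * ord_of_nat (2 ^ Suc n)"
        by (simp only: cnf_eq_iff)
      then show ?case
        using assms(2)[OF Suc] by simp
    qed (use less in \<open>simp add: ord_of_nat_1\<close>)
    \<comment> \<open>For this \<open>n\<close> the inequality \<open>n < 2 ^ n\<close> decides the
      comparison at the leading exponent.\<close>
    define n where "n = Poly_Mapping.lookup (cnf b) e"
    have "Poly_Mapping.lookup (cnf b) k = 0" if "e < k" for k
      using e(2)[of k] that by (meson in_keys_iff not_less)
    then have "lex_less (cnf b) (cnf (opow \<omega> e * ord_of_nat (2 ^ n)))"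
      unfolding lex_less_def
      by (intro exI[of _ e]) (auto simp: cnf_opow_omega_mult lookup_single when_def simp flip: n_def)
    then show False
      using *[of n] less_iff_lex_less by (metis less_asym)
  qed
  moreover have "opow \<omega> e \<le> b"
    using opow_omega_le_cnf_value[OF e(1)] by simp
  ultimately have "b = opow \<omega> e"
    by simp
  then show ?thesis
    by (rule that)
qed

text \<open>
  Natural multiplication is not continuous in general, e.g. \<open>n \<otimes> (\<omega> + 1)\<close> for finite \<open>n\<close> stays
  below \<open>\<omega>^2\<close>; for two powers of \<open>\<omega>\<close> it suffices to vary one factor at a time.
\<close>

lemma less_nat_prod_opow_omega_cases:
  assumes "z < opow \<omega> e \<otimes> opow \<omega> f"
  obtains x where "x < opow \<omega> e" "z \<le> x \<otimes> opow \<omega> f"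
  | y where "y < opow \<omega> f" "z \<le> opow \<omega> e \<otimes> y"
proof (cases "z = 0")
  case True
  then show ?thesis
    using that(1)[of 0] opow_omega_pos[of e] by simp
next
  case False
  then have "cnf z \<noteq> 0"
    using cnf_eq_iff[of z 0] by auto
  define k where "k = Max (Poly_Mapping.keys (cnf z))"
  have k: "k \<in> Poly_Mapping.keys (cnf z)" "\<And>l. l \<in> Poly_Mapping.keys (cnf z) \<Longrightarrow> l \<le> k"
    using \<open>cnf z \<noteq> 0\<close> by (auto simp: k_def)
  then have "k < e \<oplus> f"
    using assms unfolding nat_prod_opow_omega less_opow_omega_iff by blast
  \<comment> \<open>One more than the leading coefficient, so that \<open>n\<close> copies of
    \<open>opow \<omega> l\<close> exceed \<open>z\<close> for every \<open>l\<close> from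
    \<open>k\<close> on.\<close>
  define n where "n = Suc (Poly_Mapping.lookup (cnf z) k)"
  have "Poly_Mapping.lookup (cnf z) l = 0" if "k < l" for l
    using k(2)[of l] that by (meson in_keys_iff not_less)
  then have z: "z \<le> opow \<omega> l * ord_of_nat n" if "k \<le> l" for l
    unfolding le_less[of z] less_iff_lex_less[of z] lex_less_def n_def using that
    by (intro disjI1 exI[of _ l])
      (auto simp: cnf_opow_omega_mult lookup_single when_def le_less)
  have mult: "opow \<omega> (l \<oplus> l') * ord_of_nat n = (opow \<omega> l * ord_of_nat n) \<otimes> opow \<omega> l'"
    for l l' :: "'a ordinal"
  proof -
    have "cnf (opow \<omega> (l \<oplus> l') * ord_of_nat n) = cnf ((opow \<omega> l * ord_of_nat n) \<otimes> opow \<omega> l')"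
      unfolding cnf_nat_prod by (simp add: cnf_opow_omega cnf_opow_omega_mult)
    then show ?thesis
      by (simp add: cnf_eq_iff)
  qed
  from \<open>k < e \<oplus> f\<close> show ?thesis
  proof (cases rule: less_nat_sum_cases)
    \<comment> \<open>The witness is \<open>opow \<omega> e' * ord_of_nat n\<close>: it is below
      \<open>opow \<omega> e\<close> because \<open>e' < e\<close>, and \<open>mult\<close> moves
      the finite factor out of the product.\<close>
    case (1 e')
    then show ?thesis
      using that(1) opow_omega_mult_less z mult by metis
  next
    case (2 f')
    then show ?thesis
      using that(2) opow_omega_mult_less z mult by (metis nat_prod_commute nat_sum_commute)
  qed
qed


section \<open>Super-Jacobsthal exponentiation\<close>

lemma sj_pow_0 [simp]: "a ^\<otimes> 0 = 1"
  by (simp add: sj_pow_def ord_rec_0)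

lemma sj_pow_osuc: "a ^\<otimes> osuc b = (a ^\<otimes> b) \<otimes> a"
  by (simp add: sj_pow_def ord_rec_osuc)

lemma continuous_ord_sj_pow: "continuous_ord ((^\<otimes>) a)"
  unfolding sj_pow_def[abs_def] by (rule continuous_ord_rec)

lemma zero_less_one_ordinal: "0 < (1 :: 'a ordinal)"
  by (simp add: one_ordinal_def less_osuc)

lemma one_le_ordinal_iff: "1 \<le> a \<longleftrightarrow> 0 < (a :: 'a ordinal)"
  by (simp add: one_ordinal_def osuc_le_iff)

lemma SUP_const_lessThan: "0 < b \<Longrightarrow> (SUP d\<in>{..<b}. c) = (c :: 'a ordinal)" for b :: "'a ordinal"
  by (intro antisym SUP_lessThan_le) (auto intro: le_SUP_lessThan[of 0 b "\<lambda>_. c"])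

lemma sj_pow_limit: "limit_ord b \<Longrightarrow> a ^\<otimes> b = (SUP d\<in>{..<b}. a ^\<otimes> d)"
  using continuous_ord_sj_pow by (auto simp: continuous_ord_def)

lemma one_sj_pow [simp]: "1 ^\<otimes> b = 1"
proof (induction b rule: ordinal_induct)
  case (limit b)
  have "1 ^\<otimes> b = (SUP d\<in>{..<b}. 1 :: 'a ordinal)"
    unfolding sj_pow_limit[OF limit(1)] by (rule SUP_cong) (use limit in auto)
  then show ?case
    using limit(1) by (simp add: SUP_const_lessThan limit_ord_pos)
qed (simp_all add: sj_pow_osuc)

text \<open>All values are at most 1, and at a limit the supremum retains the value 1 from stage
  0.\<close>

lemma zero_sj_pow: "0 ^\<otimes> b = (if \<exists>d. b = osuc d then 0 else 1)"
proof (cases b rule: ordinal_cases)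
  case limit
  have le: "0 ^\<otimes> d \<le> 1" for d :: "'a ordinal"
  proof (induction d rule: ordinal_induct)
    case (limit d)
    then show ?case
      by (simp add: sj_pow_limit SUP_lessThan_le limit_ord_pos)
  qed (simp_all add: sj_pow_osuc)
  have "1 \<le> 0 ^\<otimes> b"
    using le_SUP_lessThan[of 0 b "(^\<otimes>) 0"] limit by (simp add: sj_pow_limit limit_ord_pos)
  then show ?thesis
    using limit le[of b] by (auto simp: limit_ord_def)
qed (auto simp: sj_pow_osuc)

lemma sj_pow_mono:
  assumes "0 < a"
  shows "mono ((^\<otimes>) a)"
proof (rule mono_continuous_ord[OF continuous_ord_sj_pow])
  show "a ^\<otimes> d \<le> a ^\<otimes> osuc d" for d
    using nat_prod_mono_left[of 1 a "a ^\<otimes> d"] assms by (simp add: sj_pow_osuc one_le_ordinal_iff)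
qed

lemma sj_pow_pos:
  assumes "0 < a"
  shows "0 < a ^\<otimes> b"
  using monoD[OF sj_pow_mono[OF assms], of 0 b] by (simp add: one_le_ordinal_iff)

lemma sj_pow_strict_mono:
  assumes "1 < a"
  shows "strict_mono ((^\<otimes>) a)"
proof (rule strict_mono_continuous_ord[OF continuous_ord_sj_pow])
  show "a ^\<otimes> d < a ^\<otimes> osuc d" for d
    using nat_prod_strict_mono[of 1 a "a ^\<otimes> d"] assms sj_pow_pos[of a d]
      less_trans[OF zero_less_one_ordinal assms]
    by (simp add: sj_pow_osuc nat_prod_commute)
qed

text \<open>
  If \<open>x \<le> a ^\<otimes> d\<close> with \<open>a \<ge> 2\<close>, then \<open>x \<oplus> x \<le> a ^\<otimes> (d + 1)\<close>, so powers of limit exponents are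
  closed under doubling.
\<close>

lemma sj_pow_limit_eq_opow_omega:
  assumes "1 < a" "limit_ord b"
  obtains e where "a ^\<otimes> b = opow \<omega> e"
proof (rule eq_opow_omegaI)
  have "0 < a"
    using zero_less_one_ordinal assms(1) by (rule less_trans)
  then show "0 < a ^\<otimes> b"
    by (rule sj_pow_pos)
  fix x
  assume "x < a ^\<otimes> b"
  then obtain d where d: "d < b" "x < a ^\<otimes> d"
    using assms(2) by (auto simp: sj_pow_limit less_SUP_lessThan_iff limit_ord_pos)
  have "x \<oplus> x \<le> a ^\<otimes> d \<oplus> a ^\<otimes> d"
    using d by (intro nat_sum_mono) auto
  also have "\<dots> = (a ^\<otimes> d) \<otimes> (1 \<oplus> 1)"
    by (simp add: nat_prod_distrib_left)
  also have "\<dots> \<le> a ^\<otimes> osuc d"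
    unfolding sj_pow_osuc using assms(1) by (intro nat_prod_mono_left) (simp add: nat_sum_one osuc_le_iff)
  also have "\<dots> < a ^\<otimes> b"
    by (rule strict_monoD[OF sj_pow_strict_mono[OF assms(1)] limit_ord_osuc_less[OF assms(2) d(1)]])
  finally show "x \<oplus> x < a ^\<otimes> b" .
qed (use that in blast)

lemma sj_pow_nat_sum_limit:
  assumes a: "1 < a" and b: "limit_ord b" and c: "limit_ord c"
    and IHb: "\<And>b'. b' < b \<Longrightarrow> a ^\<otimes> (b' \<oplus> c) = (a ^\<otimes> b') \<otimes> (a ^\<otimes> c)"
    and IHc: "\<And>c'. c' < c \<Longrightarrow> a ^\<otimes> (b \<oplus> c') = (a ^\<otimes> b) \<otimes> (a ^\<otimes> c')"
  shows "a ^\<otimes> (b \<oplus> c) = (a ^\<otimes> b) \<otimes> (a ^\<otimes> c)"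
proof (rule antisym)
  have "0 < a"
    using zero_less_one_ordinal a by (rule less_trans)
  note mono = monoD[OF sj_pow_mono[OF \<open>0 < a\<close>]]
  note smono = strict_monoD[OF sj_pow_strict_mono[OF a]]
  have lim: "limit_ord (b \<oplus> c)"
    using b c by (simp add: limit_ord_nat_sum)
  show "a ^\<otimes> (b \<oplus> c) \<le> (a ^\<otimes> b) \<otimes> (a ^\<otimes> c)"
    unfolding sj_pow_limit[OF lim]
  proof (rule SUP_lessThan_le[OF limit_ord_pos[OF lim]])
    fix d
    assume "d < b \<oplus> c"
    then show "a ^\<otimes> d \<le> (a ^\<otimes> b) \<otimes> (a ^\<otimes> c)"
    proof (cases rule: less_nat_sum_cases)
      case (1 b')
      have "a ^\<otimes> d \<le> a ^\<otimes> (b' \<oplus> c)"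
        by (rule mono[OF 1(2)])
      also have "\<dots> \<le> (a ^\<otimes> b) \<otimes> (a ^\<otimes> c)"
        using 1(1) by (simp add: IHb nat_prod_mono_right mono)
      finally show ?thesis .
    next
      case (2 c')
      have "a ^\<otimes> d \<le> a ^\<otimes> (b \<oplus> c')"
        by (rule mono[OF 2(2)])
      also have "\<dots> \<le> (a ^\<otimes> b) \<otimes> (a ^\<otimes> c)"
        using 2(1) by (simp add: IHc nat_prod_mono_left mono)
      finally show ?thesis .
    qed
  qed
  obtain e where e: "a ^\<otimes> b = opow \<omega> e"
    using a b by (rule sj_pow_limit_eq_opow_omega)
  obtain f where f: "a ^\<otimes> c = opow \<omega> f"
    using a c by (rule sj_pow_limit_eq_opow_omega)
  \<comment> \<open>Otherwise the case rule applies to \<open>a ^\<otimes> (b \<oplus> c)\<close>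
    itself. The lowered factor is passed by a power with smaller exponent, and the induction
    hypothesis then puts \<open>a ^\<otimes> (b \<oplus> c)\<close> strictly below itself.\<close>
  show "(a ^\<otimes> b) \<otimes> (a ^\<otimes> c) \<le> a ^\<otimes> (b \<oplus> c)"
  proof (rule ccontr)
    assume "\<not> (a ^\<otimes> b) \<otimes> (a ^\<otimes> c) \<le> a ^\<otimes> (b \<oplus> c)"
    then have "a ^\<otimes> (b \<oplus> c) < opow \<omega> e \<otimes> opow \<omega> f"
      by (simp add: e f)
    then show False
    proof (cases rule: less_nat_prod_opow_omega_cases)
      case (1 x)
      then obtain b' where b': "b' < b" "x < a ^\<otimes> b'"
        using b by (auto simp: sj_pow_limit less_SUP_lessThan_iff limit_ord_pos simp flip: e)
      have "a ^\<otimes> (b \<oplus> c) \<le> (a ^\<otimes> b') \<otimes> (a ^\<otimes> c)"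
        using 1(2) nat_prod_mono_right[OF less_imp_le[OF b'(2)]] unfolding f by (rule order_trans)
      also have "\<dots> < a ^\<otimes> (b \<oplus> c)"
        using b'(1) by (simp add: smono flip: IHb)
      finally show ?thesis
        by simp
    next
      case (2 y)
      then obtain c' where c': "c' < c" "y < a ^\<otimes> c'"
        using c by (auto simp: sj_pow_limit less_SUP_lessThan_iff limit_ord_pos simp flip: f)
      have "a ^\<otimes> (b \<oplus> c) \<le> (a ^\<otimes> b) \<otimes> (a ^\<otimes> c')"
        using 2(2) nat_prod_mono_left[OF less_imp_le[OF c'(2)]] unfolding e by (rule order_trans)
      also have "\<dots> < a ^\<otimes> (b \<oplus> c)"
        using c'(1) by (simp add: smono flip: IHc)
      finally show ?thesis
        by simp
    qed
  qed
qed

lemma sj_pow_nat_sum_osuc: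
  assumes "a ^\<otimes> (b \<oplus> c) = (a ^\<otimes> b) \<otimes> (a ^\<otimes> c)"
  shows "a ^\<otimes> (b \<oplus> osuc c) = (a ^\<otimes> b) \<otimes> (a ^\<otimes> osuc c)"
  using assms by (simp add: nat_sum_osuc sj_pow_osuc nat_prod_assoc)

lemma sj_pow_nat_sum: "a ^\<otimes> (b \<oplus> c) = (a ^\<otimes> b) \<otimes> (a ^\<otimes> c)"
proof (induction b arbitrary: c rule: ordinal_induct)
  case (osuc b)
  \<comment> \<open>Commutativity moves the successor to the right argument, where the recursion
    equations apply.\<close>
  have "a ^\<otimes> (c \<oplus> b) = (a ^\<otimes> c) \<otimes> (a ^\<otimes> b)"
    using osuc[of c] by (simp only: nat_sum_commute nat_prod_commute)
  from sj_pow_nat_sum_osuc[OF this] show ?case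
    by (simp only: nat_sum_commute nat_prod_commute)
next
  case (limit b)
  note IHb = limit(2)
  show ?case
  proof (induction c rule: ordinal_induct)
    case (limit c)
    consider "a < 1" | "a = 1" | "1 < a"
      by (rule linorder_cases)
    then show ?case
    proof cases
      case 1
      then have "a = 0"
        by (simp add: one_ordinal_def less_osuc_iff)
      \<comment> \<open>For base 0 all three exponents are limits, so all three powers are
        1.\<close>
      have "limit_ord (b \<oplus> c)"
        using limit(1) \<open>limit_ord b\<close> by (simp add: limit_ord_nat_sum)
      then show ?thesis
        using limit(1) \<open>limit_ord b\<close> by (simp add: \<open>a = 0\<close> zero_sj_pow limit_ord_def)
    next
      case 3
      then show ?thesis
        by (rule sj_pow_nat_sum_limit[OF _ \<open>limit_ord b\<close> limit(1) IHb limit(2)])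
    qed simp
  qed (simp_all add: sj_pow_nat_sum_osuc)
qed simp_all

text \<open>No monotonicity of \<open>s\<close> is assumed. If the supremum is attained,
  monotonicity of the power suffices; otherwise it is a limit ordinal, and the values of
  \<open>s\<close> are cofinal in it.\<close>

lemma sj_pow_SUP:
  fixes s :: "'a ordinal \<Rightarrow> 'a ordinal"
  assumes "0 < a" "0 < c"
  shows "a ^\<otimes> (SUP d\<in>{..<c}. s d) = (SUP d\<in>{..<c}. a ^\<otimes> s d)" (is "a ^\<otimes> ?S = ?P")
proof (rule antisym)
  note mono = monoD[OF sj_pow_mono[OF assms(1)]]
  show "?P \<le> a ^\<otimes> ?S"
    using assms(2) by (intro SUP_lessThan_le mono le_SUP_lessThan)
  show "a ^\<otimes> ?S \<le> ?P"
  proof (cases "\<exists>d<c. s d = ?S")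
    case True
    then show ?thesis
      using le_SUP_lessThan[of _ c "\<lambda>d. a ^\<otimes> s d"] by metis
  next
    case False
    then have less: "s d < ?S" if "d < c" for d
      using that le_SUP_lessThan[of d c s] by (auto simp: le_less)
    have "limit_ord ?S"
    proof (rule limit_ordI)
      show "0 < ?S"
        using less[OF assms(2)] by (rule le_less_trans[OF zero_le_ordinal])
      show "osuc x < ?S" if x: "x < ?S" for x
      proof -
        obtain d where "d < c" "x < s d"
          using x unfolding less_SUP_lessThan_iff[OF assms(2)] by blast
        then show ?thesis
          using less by (meson le_less_trans osuc_le_iff)
      qed
    qed
    show ?thesis
      unfolding sj_pow_limit[OF \<open>limit_ord ?S\<close>]
    proof (rule SUP_lessThan_le[OF limit_ord_pos[OF \<open>limit_ord ?S\<close>]])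
      fix x
      assume "x < ?S"
      then obtain d where d: "d < c" "x < s d"
        using assms(2) by (auto simp: less_SUP_lessThan_iff)
      have "a ^\<otimes> x \<le> a ^\<otimes> s d"
        using d(2) by (intro mono) simp
      also have "\<dots> \<le> ?P"
        using d(1) by (rule le_SUP_lessThan)
      finally show "a ^\<otimes> x \<le> ?P" .
    qed
  qed
qed


section \<open>Infinitary natural sums and products\<close>

lemma inf_nat_sum_0 [simp]: "inf_nat_sum 0 f = 0"
  by (simp add: inf_nat_sum_def ord_rec_0)

lemma inf_nat_sum_osuc: "inf_nat_sum (osuc c) f = inf_nat_sum c f \<oplus> f c"
  by (simp add: inf_nat_sum_def ord_rec_osuc)

lemma continuous_ord_inf_nat_sum: "continuous_ord (\<lambda>c. inf_nat_sum c f)"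
  unfolding inf_nat_sum_def by (rule continuous_ord_rec)

lemma inf_nat_sum_limit: "limit_ord c \<Longrightarrow> inf_nat_sum c f = (SUP d\<in>{..<c}. inf_nat_sum d f)"
  using continuous_ord_inf_nat_sum by (auto simp: continuous_ord_def)

lemma inf_nat_prod_0 [simp]: "inf_nat_prod 0 f = 1"
  by (simp add: inf_nat_prod_def ord_rec_0)

lemma inf_nat_prod_osuc: "inf_nat_prod (osuc c) f = inf_nat_prod c f \<otimes> f c"
  by (simp add: inf_nat_prod_def ord_rec_osuc)

lemma inf_nat_prod_limit: "limit_ord c \<Longrightarrow> inf_nat_prod c f = (SUP d\<in>{..<c}. inf_nat_prod d f)"
  by (simp add: inf_nat_prod_def ord_rec_limit)

text \<open>Each nonzero term raises the partial sum, so two further terms pass its successor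
  strictly. For base 0 this settles the power, which depends only on whether the exponent is a
  successor.\<close>

lemma limit_ord_inf_nat_sum:
  assumes "limit_ord c" "\<And>i. i < c \<Longrightarrow> f i \<noteq> 0"
  shows "limit_ord (inf_nat_sum c f)"
proof (rule limit_ordI)
  have mono: "inf_nat_sum d f \<le> inf_nat_sum c f" if "d < c" for d
    using that assms(1) le_SUP_lessThan[of d c "\<lambda>d. inf_nat_sum d f"]
    by (simp add: inf_nat_sum_limit)
  have less: "osuc (inf_nat_sum d f) < inf_nat_sum c f" if "d < c" for d
  proof -
    have step: "osuc x \<le> x \<oplus> f i" if "i < c" for x i
      using assms(2)[OF that] nat_sum_less_left_iff[of x 0 "f i"]
      by (simp add: osuc_le_iff neq_zero_ordinal_iff)
    have "osuc d < c"
      using assms(1) \<open>d < c\<close> by (rule limit_ord_osuc_less)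
    have "osuc (inf_nat_sum d f) \<le> inf_nat_sum (osuc d) f"
      using step[OF \<open>d < c\<close>] by (simp add: inf_nat_sum_osuc)
    also have "\<dots> < inf_nat_sum (osuc (osuc d)) f"
      using step[OF \<open>osuc d < c\<close>] by (simp add: inf_nat_sum_osuc[of "osuc d"] osuc_le_iff)
    also have "\<dots> \<le> inf_nat_sum c f"
      by (intro mono limit_ord_osuc_less assms(1) \<open>d < c\<close>)
    finally show ?thesis .
  qed
  show "0 < inf_nat_sum c f"
    using less[OF limit_ord_pos[OF assms(1)]] by (rule le_less_trans[OF zero_le_ordinal])
  show "osuc x < inf_nat_sum c f" if x: "x < inf_nat_sum c f" for x
  proof -
    obtain d where d: "d < c" "x < inf_nat_sum d f"
      using x assms(1) by (auto simp: inf_nat_sum_limit less_SUP_lessThan_iff limit_ord_pos)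
    then have "osuc x \<le> inf_nat_sum d f"
      by (simp add: osuc_le_iff)
    then show ?thesis
      using less[OF d(1)] less_osuc by (meson le_less_trans less_trans)
  qed
qed

lemma sj_pow_inf_nat_sum:
  assumes "0 < a"
  shows "a ^\<otimes> (\<Oplus>i<c. f i) = (\<Otimes>i<c. a ^\<otimes> f i)"
proof (induction c rule: ordinal_induct)
  case (osuc c)
  then show ?case
    by (simp add: inf_nat_sum_osuc inf_nat_prod_osuc sj_pow_nat_sum)
next
  case (limit c)
  then show ?case
    using assms
    by (simp add: inf_nat_sum_limit inf_nat_prod_limit sj_pow_SUP limit_ord_pos cong: SUP_cong_simp)
qed simp

lemma inf_nat_prod_le_1:
  assumes "\<And>i. i < c \<Longrightarrow> f i \<le> 1"
  shows "inf_nat_prod c f \<le> 1"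
  using assms
proof (induction c rule: ordinal_induct)
  case (osuc c)
  then have "inf_nat_prod c f \<otimes> f c \<le> 1 \<otimes> 1"
    using nat_prod_mono_right nat_prod_mono_left less_osuc
    by (meson less_trans order_trans)
  then show ?case
    by (simp add: inf_nat_prod_osuc)
next
  case (limit c)
  then show ?case
    by (auto simp: inf_nat_prod_limit limit_ord_pos intro!: SUP_lessThan_le)
qed simp

text \<open>Limit stages arise only in the case of nonzero terms. There the sum is a limit, so the
  power is 1, and the product is 1 because its factors are at most 1 and its stage 0 is 1.\<close>

lemma zero_sj_pow_inf_nat_sum:
  assumes "c < \<omega> \<or> (\<forall>i<c. f i \<noteq> 0)"
  shows "0 ^\<otimes> (\<Oplus>i<c. f i) = (\<Otimes>i<c. 0 ^\<otimes> f i)"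
  using assms
proof (induction c rule: ordinal_induct)
  case (osuc c)
  then have "c < \<omega> \<or> (\<forall>i<c. f i \<noteq> 0)"
    using less_osuc less_trans by blast
  then show ?case
    using osuc.IH by (simp add: inf_nat_sum_osuc inf_nat_prod_osuc sj_pow_nat_sum)
next
  case (limit c)
  have nz: "\<forall>i<c. f i \<noteq> 0"
    using limit.prems omega_le_limit_ord[OF limit(1)] by auto
  have "(\<Otimes>i<c. 0 ^\<otimes> f i) \<le> 1"
    by (rule inf_nat_prod_le_1) (simp add: zero_sj_pow)
  moreover have "1 \<le> (\<Otimes>i<c. 0 ^\<otimes> f i)"
    using le_SUP_lessThan[of 0 c "\<lambda>d. \<Otimes>i<d. 0 ^\<otimes> f i"] limit(1)
    by (simp add: inf_nat_prod_limit limit_ord_pos)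
  moreover have "0 ^\<otimes> (\<Oplus>i<c. f i) = 1"
    using limit_ord_inf_nat_sum[OF limit(1), of f] nz by (auto simp: zero_sj_pow limit_ord_def)
  ultimately show ?case
    by simp
qed simp

section \<open>Constant families and the final statement\<close>

lemma jacobsthal_mult_eq: "b \<times>\<^sub>J c = (\<Oplus>i<c. b)"
  by (simp add: jacobsthal_mult_def inf_nat_sum_def)

lemma sj_pow_eq_inf_nat_prod: "a ^\<otimes> c = (\<Otimes>i<c. a)"
  by (simp add: sj_pow_def inf_nat_prod_def)

lemma zero_jacobsthal_mult: "0 \<times>\<^sub>J c = 0"
proof (induction c rule: ordinal_induct)
  case (limit c)
  have "0 \<times>\<^sub>J c = (SUP d\<in>{..<c}. 0 \<times>\<^sub>J d)"
    using limit(1) by (simp add: jacobsthal_mult_eq inf_nat_sum_limit)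
  also have "\<dots> \<le> 0"
    using limit by (intro SUP_lessThan_le) (simp_all add: limit_ord_pos)
  finally show ?case
    by simp
qed (simp_all add: jacobsthal_mult_eq inf_nat_sum_osuc)

text \<open>The side condition on families rules out base 0 with an infinite family containing a
  zero term. There the law can fail: an early value 1 of the partial products survives in a supremum
  even when the sum of the exponents is a successor.\<close>

theorem theorem1p11:
  shows "(\<forall>\<alpha> \<beta> \<gamma> :: 'a ordinal. \<alpha> ^\<otimes> (\<beta> \<times>\<^sub>J \<gamma>) = (\<alpha> ^\<otimes> \<beta>) ^\<otimes> \<gamma>) \<and>
    (\<forall>(\<alpha> :: 'a ordinal) (\<gamma> :: 'a ordinal) (\<beta> :: 'a ordinal \<Rightarrow> 'a ordinal).
       \<alpha> \<noteq> 0 \<or> \<gamma> < \<omega> \<or> (\<forall>i<\<gamma>. \<beta> i \<noteq> 0) \<longrightarrow>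
       \<alpha> ^\<otimes> (\<Oplus>i<\<gamma>. \<beta> i) = (\<Otimes>i<\<gamma>. \<alpha> ^\<otimes> \<beta> i))"
proof -
  have family: "\<alpha> ^\<otimes> (\<Oplus>i<\<gamma>. \<beta> i) = (\<Otimes>i<\<gamma>. \<alpha> ^\<otimes> \<beta> i)"
    if "\<alpha> \<noteq> 0 \<or> \<gamma> < \<omega> \<or> (\<forall>i<\<gamma>. \<beta> i \<noteq> 0)"
    for \<alpha> \<gamma> :: "'a ordinal" and \<beta> :: "'a ordinal \<Rightarrow> 'a ordinal"
    using that sj_pow_inf_nat_sum[of \<alpha> \<gamma> \<beta>] zero_sj_pow_inf_nat_sum[of \<gamma> \<beta>]
    by (cases "\<alpha> = 0") (auto simp: neq_zero_ordinal_iff)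
  have "\<alpha> ^\<otimes> (\<beta> \<times>\<^sub>J \<gamma>) = (\<alpha> ^\<otimes> \<beta>) ^\<otimes> \<gamma>" for \<alpha> \<beta> \<gamma> :: "'a ordinal"
  \<comment> \<open>A constant family of zeros may violate the side condition, so it is treated
    directly: both sides are 1.\<close>
  proof (cases "\<beta> = 0")
    case True
    then show ?thesis
      by (simp add: zero_jacobsthal_mult)
  next
    case False
    then show ?thesis
      using family[of \<alpha> \<gamma> "\<lambda>_. \<beta>"] by (simp add: jacobsthal_mult_eq flip: sj_pow_eq_inf_nat_prod)
  qed
  then show ?thesis
    using family by blast
qed

end
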